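(* Let $n\ge 1$, let $\Omega\subset\mathbb{R}^n$ be open, let $r\ge 0$, and let $u\in C(\Omega)$ be a viscosity solution of $$\min(-\Delta u-r,\ |Du|-1)=0\quad\text{in }\Omega.$$ Then $u\in C^{0,1}_{\rm loc}(\Omega)$, and for every $\Omega'\Subset\Omega$ there exists a constant $C>0$, depending only on the dimension $n$ and on $\mathrm{dist}(\Omega',\partial\Omega)$, such that $$\|Du\|_{L^\infty(\Omega')}\le C\left(\|u\|_{L^\infty(\Omega)}+1\right).$$
   Context: $\Omega'\Subset\Omega$ means that $\Omega'$ is an open set whose closure is a compact subset of $\Omega$. $C^{0,1}_{\rm loc}(\Omega)$ is the space of locally Lipschitz functions, and $Du$ is the almost everywhere defined gradient. $B_\rho(x_0)$ is the open ball of radius $\rho$ centred at $x_0$. Viscosity solutions. A lower semicontinuous $u:\Omega\to\mathbb{R}$ is a viscosity super-solution, i.e. $\min(-\Delta u-r,|Du|-1)\ge 0$ in $\Omega$, if for every ball $B_\rho(x_0)\subset\Omega$ and every $\varphi\in C^\infty(B_\rho(x_0))$ with $\min_{B_\rho(x_0)}(u-\varphi)=(u-\varphi)(x_0)=0$ one has $\min(-\Delta\varphi(x_0)-r,|D\varphi(x_0)|-1)\ge 0$. An upper semicontinuous $u:\Omega\to\mathbb{R}$ is a viscosity sub-solution if for every ball $B_\rho(x_0)\subset\Omega$ and every $\varphi\in C^\infty(B_\rho(x_0))$ with $\max_{B_\rho(x_0)}(u-\varphi)=(u-\varphi)(x_0)=0$ one has $\min(-\Delta\varphi(x_0)-r,|D\varphi(x_0)|-1)\le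 0$. A viscosity solution is a continuous function that is both a super- and a sub-solution. *)

theory Defs
  imports "HOL-Analysis.Analysis" "HOL-Probability.Essential_Supremum"
begin

definition partial_derivative :: "'a::euclidean_space \<Rightarrow> ('a \<Rightarrow> real) \<Rightarrow> 'a \<Rightarrow> real" where
  "partial_derivative i f x = frechet_derivative f (at x) i"

text \<open>\<open>C_k_on k f S\<close> and \<open>smooth_on f S\<close> are meant for open \<open>S\<close>: all derivatives are taken in the
  ambient space.\<close>

fun C_k_on :: "nat \<Rightarrow> ('a::euclidean_space \<Rightarrow> real) \<Rightarrow> 'a set \<Rightarrow> bool" where
  "C_k_on 0 f S \<longleftrightarrow> continuous_on S f"
| "C_k_on (Suc k) f S \<longleftrightarrow>
     (\<forall>x\<in>S. f differentiable (at x)) \<and> (\<forall>i\<in>Basis. C_k_on k (partial_derivative i f) S)"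

definition smooth_on :: "('a::euclidean_space \<Rightarrow> real) \<Rightarrow> 'a set \<Rightarrow> bool" where
  "smooth_on f S \<longleftrightarrow> (\<forall>k. C_k_on k f S)"

text \<open>The gradient is set to 0 where \<open>f\<close> is not differentiable. For a locally Lipschitz function
  these points form a null set by Rademacher's theorem, so the value chosen there does not affect
  an essential supremum.\<close>

definition gradient :: "('a::euclidean_space \<Rightarrow> real) \<Rightarrow> 'a \<Rightarrow> 'a" where
  "gradient f x = (if f differentiable (at x) then (THE D. GDERIV f x :> D) else 0)"

definition laplacian :: "('a::euclidean_space \<Rightarrow> real) \<Rightarrow> 'a \<Rightarrow> real" where
  "laplacian f x = (\<Sum>i\<in>Basis. partial_derivative i (partial_derivative i f) x)"

definition lower_semicontinuous_on :: "'a::topological_space set \<Rightarrow> ('a \<Rightarrow> real) \<Rightarrow> bool" where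
  "lower_semicontinuous_on S u \<longleftrightarrow> (\<forall>x\<in>S. \<forall>a<u x. \<forall>\<^sub>F y in at x within S. a < u y)"

definition upper_semicontinuous_on :: "'a::topological_space set \<Rightarrow> ('a \<Rightarrow> real) \<Rightarrow> bool" where
  "upper_semicontinuous_on S u \<longleftrightarrow> (\<forall>x\<in>S. \<forall>a>u x. \<forall>\<^sub>F y in at x within S. u y < a)"

definition viscosity_supersolution ::
  "real \<Rightarrow> 'a::euclidean_space set \<Rightarrow> ('a \<Rightarrow> real) \<Rightarrow> bool" where
  "viscosity_supersolution r \<Omega> u \<longleftrightarrow>
     lower_semicontinuous_on \<Omega> u \<and>
     (\<forall>x0 \<rho> \<phi>. \<rho> > 0 \<longrightarrow> ball x0 \<rho> \<subseteq> \<Omega> \<longrightarrow> smooth_on \<phi> (ball x0 \<rho>) \<longrightarrow>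
        u x0 - \<phi> x0 = 0 \<longrightarrow> (\<forall>x\<in>ball x0 \<rho>. u x - \<phi> x \<ge> u x0 - \<phi> x0) \<longrightarrow>
        min (- laplacian \<phi> x0 - r) (norm (gradient \<phi> x0) - 1) \<ge> 0)"

definition viscosity_subsolution ::
  "real \<Rightarrow> 'a::euclidean_space set \<Rightarrow> ('a \<Rightarrow> real) \<Rightarrow> bool" where
  "viscosity_subsolution r \<Omega> u \<longleftrightarrow>
     upper_semicontinuous_on \<Omega> u \<and>
     (\<forall>x0 \<rho> \<phi>. \<rho> > 0 \<longrightarrow> ball x0 \<rho> \<subseteq> \<Omega> \<longrightarrow> smooth_on \<phi> (ball x0 \<rho>) \<longrightarrow>
        u x0 - \<phi> x0 = 0 \<longrightarrow> (\<forall>x\<in>ball x0 \<rho>. u x - \<phi> x \<le> u x0 - \<phi> x0) \<longrightarrow>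
        min (- laplacian \<phi> x0 - r) (norm (gradient \<phi> x0) - 1) \<le> 0)"

definition viscosity_solution ::
  "real \<Rightarrow> 'a::euclidean_space set \<Rightarrow> ('a \<Rightarrow> real) \<Rightarrow> bool" where
  "viscosity_solution r \<Omega> u \<longleftrightarrow>
     continuous_on \<Omega> u \<and> viscosity_supersolution r \<Omega> u \<and> viscosity_subsolution r \<Omega> u"

definition locally_lipschitz_on :: "'a::metric_space set \<Rightarrow> ('a \<Rightarrow> real) \<Rightarrow> bool" where
  "locally_lipschitz_on S u \<longleftrightarrow> (\<forall>x\<in>S. \<exists>\<rho>>0. \<exists>L. L-lipschitz_on (ball x \<rho> \<inter> S) u)"

text \<open>If \<open>\<Omega>'\<close> is compactly contained in the open set \<open>\<Omega>\<close>, then \<^term>\<open>setdist \<Omega>' (frontier \<Omega>)\<close> is 0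
  exactly when \<open>\<Omega>'\<close> or \<open>frontier \<Omega>\<close> is empty, i.e. when the distance is infinite under the convention
  that the infimum of the empty set is infinite. A constant depending on the distance can therefore
  be a function of the real number \<open>setdist\<close>, its value at 0 standing for its value at infinity.\<close>

definition compactly_contained :: "'a::topological_space set \<Rightarrow> 'a set \<Rightarrow> bool" where
  "compactly_contained \<Omega>' \<Omega> \<longleftrightarrow> open \<Omega>' \<and> compact (closure \<Omega>') \<and> closure \<Omega>' \<subseteq> \<Omega>"

text \<open>The norm takes the value \<open>\<infinity>\<close> for essentially unbounded functions, and also for functions that
  are not Lebesgue measurable on \<open>S\<close> (this is how \<open>esssup\<close> is defined).\<close>

definition Linfty_norm :: "'a::euclidean_space set \<Rightarrow> ('a \<Rightarrow> 'b::real_normed_vector) \<Rightarrow> ennreal" where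
  "Linfty_norm S f = esssup (lebesgue_on S) (\<lambda>x. ennreal (norm (f x)))"

end

theory Submission
  imports Defs
begin

text \<open>The estimate is proved by doubling the variables, in the manner of Ishii and Lions. Fix
  \<open>cball x0 R \<subseteq> \<Omega>\<close> on which \<open>\<bar>u\<bar> \<le> N\<close>, and put \<open>\<phi> t = L t - Q t\<^sup>2\<close>. The claim is that
  \<open>F(x, y) = u x - u y - \<phi> \<bar>x - y\<bar> - M \<bar>x - x0\<bar>\<^sup>2\<close> is nonpositive for \<open>\<bar>x - x0\<bar>\<close> and
  \<open>\<bar>x - y\<bar>\<close> at most \<open>R / 2\<close>; the case \<open>x = x0\<close> bounds \<open>u x0 - u y\<close> by \<open>L \<bar>x0 - y\<bar>\<close>. If
  \<open>M R\<^sup>2 / 4 = 2 N\<close> and \<open>\<phi> (R / 2) \<ge> 2 N\<close>, a positive maximum of \<open>F\<close> lies in the interior and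
  off the diagonal.

  Suppose for a moment that \<open>u\<close> is smooth at the \<open>y\<close>-component \<open>y'\<close> of the maximum point
  \<open>(x', y')\<close>. Move the two points together, \<open>y\<close> being the mirror image of \<open>x\<close> in the hyperplane
  that bisects the segment from \<open>x'\<close> to \<open>y'\<close>. As a function of \<open>x\<close> alone, the remaining terms
  then form a smooth function that touches \<open>u\<close> from above at \<open>x'\<close>. A reflection preserves
  the Laplacian of \<open>u\<close>, which is at most \<open>- r\<close>, while \<open>\<bar>x - y\<bar>\<close> changes at twice the speed
  of \<open>x\<close> in the direction of \<open>x' - y'\<close>, so that \<open>\<phi>\<close> contributes \<open>4 \<phi>'' = - 8 Q\<close>. In dimension \<open>n\<close> this
  outweighs the contribution \<open>2 n M\<close> of the localization, and the test function has Laplacian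
  below \<open>- r\<close>. Its gradient has length at least \<open>\<phi>' - 2 M \<bar>x' - x0\<bar> > 1\<close>. This contradicts
  the sub-solution property (lemma \<open>no_interior_maximum\<close>). All constants are linear in \<open>N\<close>, and \<open>r\<close> does not enter them.

  To reach the smooth situation, let \<open>(a, b)\<close> be a maximum point of \<open>F\<close> and replace \<open>u y\<close>, for \<open>y\<close>
  in a small ball around \<open>b\<close>, by a polynomial \<open>h\<close> with Laplacian \<open>2 - r\<close> that nearly agrees
  with \<open>u\<close> on the boundary sphere. Since \<open>u\<close> is a super-solution of \<open>- \<Delta> u = r\<close>, comparison shows that
  \<open>h\<close> lies strictly below \<open>u\<close> at \<open>b\<close>. So the replacement raises the value at \<open>(a, b)\<close> by more than it
  can raise values with \<open>y\<close> on the sphere, and the new maximum is attained with \<open>y\<close> in the open ball, where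
  \<open>h\<close> is smooth (lemmas \<open>lowered_replacement\<close> and \<open>doubling_estimate\<close>). That the Laplacian of
  \<open>h\<close> exceeds \<open>- r\<close> by \<open>2\<close> is absorbed by the choice of \<open>Q\<close>.

  The polynomials come from the Stone-Weierstrass theorem together with the fact that the Dirichlet
  problem in a ball with polynomial data has a polynomial solution
  (lemmas \<open>homogeneous_dirichlet\<close> and \<open>harmonic_polynomials_dense\<close>).\<close>

section \<open>Gradients and Laplacians of polynomials\<close>

lemma bounded_linear_eq_inner:
  fixes f :: "'a::euclidean_space \<Rightarrow> real"
  assumes "bounded_linear f" shows "f = (\<lambda>h. h \<bullet> (\<Sum>i\<in>Basis. f i *\<^sub>R i))"
proof
  interpret f: bounded_linear f by fact
  fix h
  have "f h = f (\<Sum>i\<in>Basis. (h \<bullet> i) *\<^sub>R i)" by (simp add: euclidean_representation)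
  then show "f h = h \<bullet> (\<Sum>i\<in>Basis. f i *\<^sub>R i)"
    by (simp add: f.sum f.scaleR inner_sum_right mult.commute)
qed

lemma differentiable_imp_gderiv:
  fixes f :: "'a::euclidean_space \<Rightarrow> real"
  assumes "f differentiable (at x)" obtains D where "GDERIV f x :> D"
proof -
  obtain f' where f': "(f has_derivative f') (at x)" using assms by (auto simp: differentiable_def)
  then show ?thesis
    using that bounded_linear_eq_inner[OF has_derivative_bounded_linear[OF f']]
    unfolding gderiv_def by metis
qed

lemma gradient_eqI:
  assumes "GDERIV f x :> D" shows "gradient f x = D"
proof -
  have "E = D" if "GDERIV f x :> E" for E
  proof -
    have "(\<lambda>h. h \<bullet> E) = (\<lambda>h. h \<bullet> D)"
      using that assms has_derivative_unique unfolding gderiv_def by blast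
    then have "(E - D) \<bullet> (E - D) = 0" by (metis cancel_comm_monoid_add_class.diff_cancel inner_diff_right)
    then show ?thesis by simp
  qed
  then show ?thesis using assms unfolding gradient_def
    by (metis (no_types, lifting) differentiable_def gderiv_def the_equality)
qed

text \<open>Carrying the full second derivative, rather than the partial derivatives, makes the chain rule
  under an affine change of variables immediate; the reflected test function of the doubling argument
  needs it.\<close>

definition has_grad_hess ::
  "('a::euclidean_space \<Rightarrow> real) \<Rightarrow> ('a \<Rightarrow> 'a) \<Rightarrow> ('a \<Rightarrow> 'a \<Rightarrow> 'a) \<Rightarrow> bool" where
  "has_grad_hess p G A \<longleftrightarrow> (\<forall>x. GDERIV p x :> G x \<and> (G has_derivative A x) (at x))"

lemma has_grad_hess_linear:
  assumes "bounded_linear f"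
  shows "has_grad_hess f (\<lambda>x. \<Sum>i\<in>Basis. f i *\<^sub>R i) (\<lambda>x h. 0)"
  unfolding has_grad_hess_def gderiv_def
  using bounded_linear_imp_has_derivative[OF assms] bounded_linear_eq_inner[OF assms]
  by (metis has_derivative_const)

lemma has_grad_hess_const: "has_grad_hess (\<lambda>x. c) (\<lambda>x. 0) (\<lambda>x h. 0)"
  by (simp add: has_grad_hess_def GDERIV_const)

lemma has_grad_hess_add:
  assumes "has_grad_hess p G A" "has_grad_hess q H B"
  shows "has_grad_hess (\<lambda>x. p x + q x) (\<lambda>x. G x + H x) (\<lambda>x h. A x h + B x h)"
  using assms by (auto simp: has_grad_hess_def intro: GDERIV_add has_derivative_add)

lemma has_grad_hess_mult:
  assumes "has_grad_hess p G A" "has_grad_hess q H B"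
  shows "has_grad_hess (\<lambda>x. p x * q x) (\<lambda>x. p x *\<^sub>R H x + q x *\<^sub>R G x)
     (\<lambda>x h. (p x *\<^sub>R B x h + (h \<bullet> G x) *\<^sub>R H x) + (q x *\<^sub>R A x h + (h \<bullet> H x) *\<^sub>R G x))"
  using assms unfolding has_grad_hess_def
  by (intro allI conjI GDERIV_mult has_derivative_add has_derivative_scaleR) (auto simp: gderiv_def)

lemma has_grad_hess_cmult:
  assumes "has_grad_hess p G A"
  shows "has_grad_hess (\<lambda>x. c * p x) (\<lambda>x. c *\<^sub>R G x) (\<lambda>x h. c *\<^sub>R A x h)"
  using has_grad_hess_mult[OF has_grad_hess_const[of c] assms] by simp

text \<open>Used with \<open>T\<close> the identity (translations) and \<open>T\<close> a reflection.\<close>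

lemma has_grad_hess_affine:
  assumes "has_grad_hess p G A" "bounded_linear T" "\<And>x y. T x \<bullet> y = x \<bullet> T y"
  shows "has_grad_hess (\<lambda>x. p (c + T x)) (\<lambda>x. T (G (c + T x))) (\<lambda>x h. T (A (c + T x) (T h)))"
proof -
  have dT: "((\<lambda>x. c + T x) has_derivative T) (at x)" for x
    using has_derivative_add[OF has_derivative_const[of c] bounded_linear_imp_has_derivative[OF assms(2)]]
    by simp
  have "((\<lambda>x. p (c + T x)) has_derivative (\<lambda>h. T h \<bullet> G (c + T x))) (at x)" for x
    using has_derivative_compose[OF dT[of x], of p "\<lambda>h. h \<bullet> G (c + T x)"] assms(1)
    by (simp add: has_grad_hess_def gderiv_def)
  moreover have "((\<lambda>x. G (c + T x)) has_derivative (\<lambda>h. A (c + T x) (T h))) (at x)" for x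
    using has_derivative_compose[OF dT[of x], of G "A (c + T x)"] assms(1)
    by (simp add: has_grad_hess_def)
  ultimately show ?thesis
    using assms(3) by (auto simp: has_grad_hess_def gderiv_def intro: bounded_linear.has_derivative[OF assms(2)])
qed

lemma real_polynomial_has_grad_hess:
  fixes p :: "'a::euclidean_space \<Rightarrow> real"
  assumes "real_polynomial_function p"
  obtains G A where "has_grad_hess p G A"
proof -
  have "\<exists>G A. has_grad_hess p G A"
    using assms
  proof induction
    case (linear f) then show ?case using has_grad_hess_linear by blast
  next
    case (const c) show ?case using has_grad_hess_const by blast
  next
    case (add f g) then show ?case using has_grad_hess_add by blast
  next
    case (mult f g) then show ?case using has_grad_hess_mult by blast
  qed
  then show ?thesis using that by blast
qed

lemma has_grad_hess_gradient: "has_grad_hess p G A \<Longrightarrow> gradient p x = G x"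
  by (simp add: has_grad_hess_def gradient_eqI)

lemma has_grad_hess_partial:
  assumes "has_grad_hess p G A" shows "partial_derivative i p = (\<lambda>x. i \<bullet> G x)"
proof
  fix x
  have "(p has_derivative (\<lambda>h. h \<bullet> G x)) (at x)"
    using assms by (simp add: has_grad_hess_def gderiv_def)
  then show "partial_derivative i p x = i \<bullet> G x"
    unfolding partial_derivative_def by (simp add: frechet_derivative_at[symmetric])
qed

lemma has_grad_hess_laplacian:
  assumes "has_grad_hess p G A" shows "laplacian p x = (\<Sum>i\<in>Basis. i \<bullet> A x i)"
proof -
  have "((\<lambda>x. i \<bullet> G x) has_derivative (\<lambda>h. i \<bullet> A x h)) (at x)" for i
    using assms by (auto simp: has_grad_hess_def intro!: derivative_eq_intros)
  then have "frechet_derivative (\<lambda>x. i \<bullet> G x) (at x) = (\<lambda>h. i \<bullet> A x h)" for i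
    by (metis frechet_derivative_at)
  then show ?thesis
    unfolding laplacian_def has_grad_hess_partial[OF assms] unfolding partial_derivative_def by simp
qed

lemma partial_derivative_add:
  assumes "real_polynomial_function p" "real_polynomial_function q"
  shows "partial_derivative i (\<lambda>x. p x + q x) = (\<lambda>x. partial_derivative i p x + partial_derivative i q x)"
proof -
  obtain G A H B where "has_grad_hess p G A" "has_grad_hess q H B"
    using assms real_polynomial_has_grad_hess by metis
  then show ?thesis
    using has_grad_hess_partial[OF has_grad_hess_add]
    by (simp add: has_grad_hess_partial inner_add_right)
qed

lemma partial_derivative_mult:
  assumes "real_polynomial_function p" "real_polynomial_function q"
  shows "partial_derivative i (\<lambda>x. p x * q x)
    = (\<lambda>x. p x * partial_derivative i q x + q x * partial_derivative i p x)"
proof -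
  obtain G A H B where "has_grad_hess p G A" "has_grad_hess q H B"
    using assms real_polynomial_has_grad_hess by metis
  then show ?thesis
    using has_grad_hess_partial[OF has_grad_hess_mult]
    by (simp add: has_grad_hess_partial inner_add_right)
qed

lemma partial_derivative_const: "partial_derivative i (\<lambda>x. c) = (\<lambda>x. 0)"
  by (simp add: has_grad_hess_partial[OF has_grad_hess_const])

lemma partial_derivative_linear:
  assumes "bounded_linear f" shows "partial_derivative i f = (\<lambda>x. f i)"
proof
  show "partial_derivative i f x = f i" for x
    unfolding partial_derivative_def
    using bounded_linear_imp_has_derivative[OF assms, of "at x"]
    by (metis frechet_derivative_at)
qed

lemma real_polynomial_partial_derivative:
  assumes "real_polynomial_function p"
  shows "real_polynomial_function (partial_derivative i p)"
  using assms
proof induction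
  case (linear f) then show ?case by (simp add: partial_derivative_linear real_polynomial_function.intros(2))
next
  case (const c) then show ?case by (simp add: partial_derivative_const real_polynomial_function.intros(2))
next
  case (add f g) then show ?case by (simp add: partial_derivative_add real_polynomial_function.intros(3))
next
  case (mult f g) then show ?case
    by (simp add: partial_derivative_mult real_polynomial_function.intros(3) real_polynomial_function.intros(4))
qed

lemma real_polynomial_smooth_on:
  assumes "real_polynomial_function p" shows "smooth_on p S"
proof -
  have "C_k_on k p S" for k
    using assms
  proof (induction k arbitrary: p)
    case 0 then show ?case by (simp add: continuous_on_polymonial_function real_polynomial_function_eq)
  next
    case (Suc k) then show ?case
      by (simp add: differentiable_at_real_polynomial_function real_polynomial_partial_derivative)
  qed
  then show ?thesis by (simp add: smooth_on_def)
qed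

text \<open>From here on the test functions are polynomials, so that each differentiation rule can be stated
  under the single hypothesis of being a polynomial.\<close>

lemma laplacian_add:
  assumes "real_polynomial_function p" "real_polynomial_function q"
  shows "laplacian (\<lambda>x. p x + q x) x = laplacian p x + laplacian q x"
  by (simp add: laplacian_def partial_derivative_add real_polynomial_partial_derivative assms sum.distrib)

lemma laplacian_mult:
  assumes "real_polynomial_function p" "real_polynomial_function q"
  shows "laplacian (\<lambda>x. p x * q x) x = p x * laplacian q x + q x * laplacian p x
    + 2 * (\<Sum>i\<in>Basis. partial_derivative i p x * partial_derivative i q x)"
  by (simp add: laplacian_def partial_derivative_add partial_derivative_mult
      real_polynomial_partial_derivative real_polynomial_function.intros(4) assms sum.distrib
      sum_distrib_left algebra_simps)

lemma laplacian_const: "laplacian (\<lambda>x. c) x = 0"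
  by (simp add: laplacian_def partial_derivative_const)

lemma laplacian_cmult:
  assumes "real_polynomial_function p"
  shows "laplacian (\<lambda>x. c * p x) x = c * laplacian p x"
  using laplacian_mult[OF real_polynomial_function.intros(2) assms]
  by (simp add: laplacian_const partial_derivative_const)

lemma laplacian_diff:
  assumes "real_polynomial_function p" "real_polynomial_function q"
  shows "laplacian (\<lambda>x. p x - q x) x = laplacian p x - laplacian q x"
proof -
  have "real_polynomial_function (\<lambda>x. (-1) * q x)"
    by (intro real_polynomial_function.intros(2,4) assms)
  then show ?thesis
    using laplacian_add[OF assms(1), of "\<lambda>x. (-1) * q x" x] laplacian_cmult[OF assms(2), of "-1" x]
    by simp
qed

lemma has_grad_hess_sq: "has_grad_hess (\<lambda>x. (x - a) \<bullet> (x - a)) (\<lambda>x. 2 *\<^sub>R (x - a)) (\<lambda>x h. 2 *\<^sub>R h)"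
  unfolding has_grad_hess_def gderiv_def
  by (auto intro!: derivative_eq_intros simp: inner_commute algebra_simps)

lemma real_polynomial_sq: "real_polynomial_function (\<lambda>x::'a::euclidean_space. (x - a) \<bullet> (x - a))"
  by (subst euclidean_inner)
     (intro real_polynomial_function_sum real_polynomial_function.intros(4),
      auto simp: inner_diff_left intro!: real_polynomial_function_diff bounded_linear_inner_left)

lemma laplacian_sq: "laplacian (\<lambda>x::'a::euclidean_space. (x - a) \<bullet> (x - a)) x = 2 * DIM('a)"
  by (simp add: has_grad_hess_laplacian[OF has_grad_hess_sq])

section \<open>Homogeneous polynomials and the Dirichlet problem in a ball\<close>

inductive homogeneous_poly :: "nat \<Rightarrow> ('a::euclidean_space \<Rightarrow> real) \<Rightarrow> bool" where
  const: "homogeneous_poly 0 (\<lambda>x. c)"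
| coord: "homogeneous_poly k p \<Longrightarrow> homogeneous_poly (Suc k) (\<lambda>x. (x \<bullet> i) * p x)"
| add: "homogeneous_poly k p \<Longrightarrow> homogeneous_poly k q \<Longrightarrow> homogeneous_poly k (\<lambda>x. p x + q x)"

lemma homogeneous_poly_real_polynomial:
  "homogeneous_poly k p \<Longrightarrow> real_polynomial_function p"
  by (induction rule: homogeneous_poly.induct)
     (auto intro: real_polynomial_function.intros(2-4)
        real_polynomial_function.intros(1)[OF bounded_linear_inner_left])

lemma homogeneous_poly_zero: "homogeneous_poly k (\<lambda>x::'a::euclidean_space. 0)"
proof (induction k)
  case 0 show ?case by (rule homogeneous_poly.const)
next
  case (Suc k) then show ?case using homogeneous_poly.coord[of k "\<lambda>x::'a. 0" 0] by simp
qed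

lemma homogeneous_poly_mult:
  assumes "homogeneous_poly j p" "homogeneous_poly k q"
  shows "homogeneous_poly (j + k) (\<lambda>x. p x * q x)"
  using assms(1)
proof induction
  case (const c)
  show ?case using assms(2)
  proof induction
    case (const d) show ?case using homogeneous_poly.const[of "c * d"] by simp
  next
    case (coord k p i) then show ?case
      using homogeneous_poly.coord[of "0 + k" "\<lambda>x. c * p x" i] by (simp add: mult.left_commute)
  next
    case (add k p q) then show ?case
      using homogeneous_poly.add by (fastforce simp: distrib_left)
  qed
next
  case (coord j p i) then show ?case
    using homogeneous_poly.coord[of "j + k" "\<lambda>x. p x * q x" i] by (simp add: mult.assoc)
next
  case (add j p q') then show ?case
    using homogeneous_poly.add by (fastforce simp: distrib_right)
qed

lemma homogeneous_poly_cmult: "homogeneous_poly k p \<Longrightarrow> homogeneous_poly k (\<lambda>x. c * p x)"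
  using homogeneous_poly_mult[OF homogeneous_poly.const] by fastforce

lemma homogeneous_poly_sum:
  assumes "\<And>i. i \<in> I \<Longrightarrow> homogeneous_poly k (p i)" "finite I"
  shows "homogeneous_poly k (\<lambda>x. \<Sum>i\<in>I. p i x)"
  using assms(2,1)
  by (induction I rule: finite_induct) (auto simp: homogeneous_poly_zero intro: homogeneous_poly.add)

lemma homogeneous_poly_inner: "homogeneous_poly 1 (\<lambda>x. x \<bullet> i)"
  using homogeneous_poly.coord[OF homogeneous_poly.const[of 1], of i] by simp

lemma homogeneous_poly_sq_mult:
  assumes "homogeneous_poly k p" shows "homogeneous_poly (k + 2) (\<lambda>x. (x \<bullet> x) * p x)"
proof -
  have "homogeneous_poly (1 + 1) (\<lambda>x::'a. \<Sum>i\<in>Basis. (x \<bullet> i) * (x \<bullet> i))"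
    by (intro homogeneous_poly_sum homogeneous_poly_mult homogeneous_poly_inner) simp
  then have "homogeneous_poly 2 (\<lambda>x::'a. x \<bullet> x)"
    by (subst euclidean_inner) (simp add: numeral_2_eq_2)
  then show ?thesis using homogeneous_poly_mult[OF _ assms] by (fastforce simp: add.commute)
qed

lemma partial_derivative_coord_mult:
  assumes "real_polynomial_function p"
  shows "partial_derivative j (\<lambda>x. (x \<bullet> i) * p x) = (\<lambda>x. (x \<bullet> i) * partial_derivative j p x + p x * (j \<bullet> i))"
  by (simp add: partial_derivative_mult assms real_polynomial_function.intros(1) bounded_linear_inner_left
      partial_derivative_linear)

lemma homogeneous_poly_partial_derivative:
  assumes "homogeneous_poly k p"
  shows "(k = 0 \<longrightarrow> partial_derivative j p = (\<lambda>x. 0)) \<and> homogeneous_poly (k - 1) (partial_derivative j p)"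
  using assms
proof induction
  case (const c) show ?case by (simp add: partial_derivative_const homogeneous_poly_zero)
next
  case (coord k p i)
  have "homogeneous_poly k (\<lambda>x. (x \<bullet> i) * partial_derivative j p x)"
  proof (cases k)
    case 0 then show ?thesis using coord.IH by (simp add: homogeneous_poly_zero)
  next
    case (Suc m) then show ?thesis using coord.IH homogeneous_poly.coord[of m _ i] by simp
  qed
  then have "homogeneous_poly k (\<lambda>x. (x \<bullet> i) * partial_derivative j p x + (j \<bullet> i) * p x)"
    using homogeneous_poly.add homogeneous_poly_cmult[OF coord.hyps] by blast
  then have "homogeneous_poly k (partial_derivative j (\<lambda>x. (x \<bullet> i) * p x))"
    unfolding partial_derivative_coord_mult[OF homogeneous_poly_real_polynomial[OF coord.hyps]]
    by (simp only: mult.commute)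
  then show ?case by simp
next
  case (add k p q)
  then show ?case
    by (simp add: partial_derivative_add homogeneous_poly_real_polynomial homogeneous_poly.add)
qed

lemma homogeneous_poly_laplacian:
  assumes "homogeneous_poly k p"
  shows "homogeneous_poly (k - 2) (laplacian p)" and "k < 2 \<Longrightarrow> laplacian p = (\<lambda>x. 0)"
proof -
  have *: "homogeneous_poly (k - 1) (partial_derivative j p)" for j
    using homogeneous_poly_partial_derivative[OF assms] by blast
  have **: "homogeneous_poly (k - 2) (partial_derivative j (partial_derivative j p))" for j
    using homogeneous_poly_partial_derivative[OF *, of j j] by (simp add: numeral_2_eq_2)
  show "homogeneous_poly (k - 2) (laplacian p)"
    unfolding laplacian_def by (intro homogeneous_poly_sum ** finite_Basis)
  show "laplacian p = (\<lambda>x. 0)" if "k < 2"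
    unfolding laplacian_def using homogeneous_poly_partial_derivative[OF *] that by auto
qed

lemma homogeneous_poly_euler:
  assumes "homogeneous_poly k p"
  shows "(\<Sum>i\<in>Basis. (x \<bullet> i) * partial_derivative i p x) = real k * p x"
  using assms
proof induction
  case (const c) show ?case by (simp add: partial_derivative_const)
next
  case (coord k p i)
  have "(\<Sum>j\<in>Basis. (x \<bullet> j) * ((x \<bullet> i) * partial_derivative j p x + p x * (j \<bullet> i)))
    = (x \<bullet> i) * (\<Sum>j\<in>Basis. (x \<bullet> j) * partial_derivative j p x) + p x * (\<Sum>j\<in>Basis. (x \<bullet> j) * (i \<bullet> j))"
    by (simp add: sum_distrib_left sum.distrib algebra_simps inner_commute)
  also have "\<dots> = (x \<bullet> i) * (real k * p x) + p x * (x \<bullet> i)"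
    by (simp add: coord.IH euclidean_inner[symmetric])
  finally show ?case
    unfolding partial_derivative_coord_mult[OF homogeneous_poly_real_polynomial[OF coord.hyps]]
    by (simp add: algebra_simps)
next
  case (add k p q)
  then show ?case
    by (simp add: partial_derivative_add homogeneous_poly_real_polynomial distrib_left sum.distrib)
qed

text \<open>The mixed term of the product rule is \<open>4 \<Sum>i. x\<^sub>i \<partial>\<^sub>i p\<close>, which is a multiple of \<open>p\<close> by Euler's
  identity.\<close>

lemma laplacian_sq_mult:
  assumes "homogeneous_poly k (p :: 'a::euclidean_space \<Rightarrow> real)"
  shows "laplacian (\<lambda>x. (x \<bullet> x) * p x) x = (x \<bullet> x) * laplacian p x + (4 * real k + 2 * real DIM('a)) * p x"
proof -
  have "(\<Sum>i\<in>Basis. partial_derivative i (\<lambda>x. x \<bullet> x) x * partial_derivative i p x) = 2 * (real k * p x)"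
  proof -
    have "(\<Sum>i\<in>Basis. partial_derivative i (\<lambda>x. x \<bullet> x) x * partial_derivative i p x)
      = (\<Sum>i\<in>Basis. 2 * ((x \<bullet> i) * partial_derivative i p x))"
      using has_grad_hess_partial[OF has_grad_hess_sq[of "0::'a"]] by (simp add: inner_commute mult.assoc)
    then show ?thesis by (simp only: sum_distrib_left[symmetric] homogeneous_poly_euler[OF assms])
  qed
  then show ?thesis
    using laplacian_mult[OF real_polynomial_sq[of 0] homogeneous_poly_real_polynomial[OF assms], of x]
      laplacian_sq[of 0 x]
    by (simp add: algebra_simps)
qed

lemma homogeneous_poly_sq_power_mult:
  "homogeneous_poly k p \<Longrightarrow> homogeneous_poly (k + 2 * j) (\<lambda>x. (x \<bullet> x) ^ j * p x)"
proof (induction j)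
  case (Suc j) then show ?case using homogeneous_poly_sq_mult[of "k + 2 * j"] by (fastforce simp: mult.assoc)
qed simp

lemma laplacian_sq_power_mult:
  assumes "homogeneous_poly k (p :: 'a::euclidean_space \<Rightarrow> real)"
  shows "\<exists>c>0. \<forall>x. laplacian (\<lambda>x. (x \<bullet> x) ^ Suc j * p x) x = c * ((x \<bullet> x) ^ j * p x) + (x \<bullet> x) ^ Suc j * laplacian p x"
proof (induction j)
  case 0
  have "0 < 4 * real k + 2 * real DIM('a)" by (simp add: add_nonneg_pos)
  then show ?case using laplacian_sq_mult[OF assms] by (intro exI[of _ "4 * real k + 2 * real DIM('a)"]) simp
next
  case (Suc j)
  then obtain c where c: "c > 0" "\<And>x. laplacian (\<lambda>x. (x \<bullet> x) ^ Suc j * p x) x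
      = c * ((x \<bullet> x) ^ j * p x) + (x \<bullet> x) ^ Suc j * laplacian p x" by blast
  define d where "d = c + 4 * real (k + 2 * Suc j) + 2 * real DIM('a)"
  have "d > 0" using c(1) by (simp add: d_def add_pos_nonneg)
  moreover have "laplacian (\<lambda>x. (x \<bullet> x) ^ Suc (Suc j) * p x) x
      = d * ((x \<bullet> x) ^ Suc j * p x) + (x \<bullet> x) ^ Suc (Suc j) * laplacian p x" for x
    using laplacian_sq_mult[OF homogeneous_poly_sq_power_mult[OF assms, of "Suc j"], of x]
    unfolding c(2) by (simp add: d_def algebra_simps)
  ultimately show ?case by blast
qed

text \<open>The product \<open>((x \<bullet> x) ^ (j + 1) - s ^ (j + 1)) * g x\<close> vanishes on the sphere, and by
  \<open>laplacian_sq_power_mult\<close> its Laplacian is a positive multiple of the desired right-hand side plus terms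
  in which \<open>g\<close> is replaced by its Laplacian. Since the latter has degree \<open>k - 2\<close>, induction on the
  degree removes these terms. The powers of \<open>x \<bullet> x\<close> in the statement are what makes the
  induction close: one of the terms left over is \<open>(x \<bullet> x) ^ (j + 1)\<close> times the Laplacian of \<open>g\<close>,
  which is of the same total degree as the right-hand side.\<close>

lemma homogeneous_dirichlet:
  assumes "homogeneous_poly k (g :: 'a::euclidean_space \<Rightarrow> real)"
  shows "\<exists>f. real_polynomial_function f \<and> (\<forall>x. laplacian f x = (x \<bullet> x) ^ j * g x)
    \<and> (\<forall>x. x \<bullet> x = s \<longrightarrow> f x = 0)"
  using assms
proof (induction k arbitrary: j g rule: less_induct)
  case (less k)
  have g: "real_polynomial_function g"
    using less.prems homogeneous_poly_real_polynomial by blast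
  have sq: "real_polynomial_function (\<lambda>x::'a. (x \<bullet> x) ^ Suc j * g x)"
    using homogeneous_poly_real_polynomial homogeneous_poly_sq_power_mult less.prems by blast
  have sg: "real_polynomial_function (\<lambda>x::'a. s ^ Suc j * g x)"
    by (intro real_polynomial_function.intros(2,4) g)
  obtain c where c: "c > 0" "\<And>x. laplacian (\<lambda>x. (x \<bullet> x) ^ Suc j * g x) x
      = c * ((x \<bullet> x) ^ j * g x) + (x \<bullet> x) ^ Suc j * laplacian g x"
    using laplacian_sq_power_mult[OF less.prems] by blast
  have "\<exists>f1. real_polynomial_function f1 \<and> (\<forall>x. laplacian f1 x = (x \<bullet> x) ^ Suc j * laplacian g x)
      \<and> (\<forall>x. x \<bullet> x = s \<longrightarrow> f1 x = 0)"
    "\<exists>f2. real_polynomial_function f2 \<and> (\<forall>x. laplacian f2 x = (x \<bullet> x) ^ 0 * laplacian g x)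
      \<and> (\<forall>x. x \<bullet> x = s \<longrightarrow> f2 x = 0)"
  proof -
    have "\<exists>f1. real_polynomial_function f1 \<and> (\<forall>x. laplacian f1 x = (x \<bullet> x) ^ i * laplacian g x)
      \<and> (\<forall>x. x \<bullet> x = s \<longrightarrow> f1 x = 0)" for i
    proof (cases "k < 2")
      case True
      then have "laplacian g x = 0" for x using homogeneous_poly_laplacian(2)[OF less.prems] by simp
      then show ?thesis by (intro exI[of _ "\<lambda>x. 0"]) (simp add: laplacian_const real_polynomial_function.intros(2))
    next
      case False
      then show ?thesis using less.IH[of "k - 2" "laplacian g" i] homogeneous_poly_laplacian(1)[OF less.prems] by simp
    qed
    then show "\<exists>f1. real_polynomial_function f1 \<and> (\<forall>x. laplacian f1 x = (x \<bullet> x) ^ Suc j * laplacian g x)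
      \<and> (\<forall>x. x \<bullet> x = s \<longrightarrow> f1 x = 0)"
    "\<exists>f2. real_polynomial_function f2 \<and> (\<forall>x. laplacian f2 x = (x \<bullet> x) ^ 0 * laplacian g x)
      \<and> (\<forall>x. x \<bullet> x = s \<longrightarrow> f2 x = 0)" by blast+
  qed
  then obtain f1 f2 where f1: "real_polynomial_function f1"
      "\<And>x. laplacian f1 x = (x \<bullet> x) ^ Suc j * laplacian g x" "\<And>x. x \<bullet> x = s \<Longrightarrow> f1 x = 0"
    and f2: "real_polynomial_function f2" "\<And>x. laplacian f2 x = laplacian g x" "\<And>x. x \<bullet> x = s \<Longrightarrow> f2 x = 0"
    by auto
  define e where "e = (\<lambda>x. ((x \<bullet> x) ^ Suc j * g x - s ^ Suc j * g x) - f1 x)"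
  define f where "f = (\<lambda>x. (1 / c) * (e x + s ^ Suc j * f2 x))"
  have e: "real_polynomial_function e"
    unfolding e_def by (intro real_polynomial_function_diff sq sg f1(1))
  have e': "laplacian e x = c * ((x \<bullet> x) ^ j * g x) - s ^ Suc j * laplacian g x" for x
    unfolding e_def
    by (simp only: laplacian_diff[OF real_polynomial_function_diff[OF sq sg] f1(1)] laplacian_diff[OF sq sg]
        laplacian_cmult[OF g] c(2) f1(2))
  have f2': "real_polynomial_function (\<lambda>x. s ^ Suc j * f2 x)"
    by (intro real_polynomial_function.intros(2,4) f2(1))
  have "real_polynomial_function f"
    unfolding f_def by (intro real_polynomial_function.intros(2-4) e f2(1))
  moreover have "laplacian f x = (x \<bullet> x) ^ j * g x" for x
    unfolding f_def using c(1)
    by (simp only: laplacian_cmult[OF real_polynomial_function.intros(3)[OF e f2']] laplacian_add[OF e f2']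
        laplacian_cmult[OF f2(1)] e' f2(2)) simp
  moreover have "f x = 0" if "x \<bullet> x = s" for x
    using that f1(3) f2(3) by (simp add: f_def e_def)
  ultimately show ?case by blast
qed

section \<open>Maximum principles\<close>

lemma second_derivative_at_local_min:
  assumes p: "has_grad_hess p G A" and e: "e > 0" and min: "\<And>y. y \<in> ball x e \<Longrightarrow> p x \<le> p y"
  shows "v \<bullet> A x v \<ge> 0"
proof -
  have "(\<lambda>h. h \<bullet> G x) = (\<lambda>h. 0)"
    using differential_zero_maxmin[of x "ball x e" p] p e min
    by (auto simp: has_grad_hess_def gderiv_def)
  then have "G x \<bullet> G x = 0" by metis
  then have G0: "G x = 0" by simp
  show ?thesis
  proof (rule ccontr)
    assume neg: "\<not> v \<bullet> A x v \<ge> 0"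
    then have "v \<noteq> 0" by auto
    have d1: "DERIV (\<lambda>t. p (x + t *\<^sub>R v)) t :> v \<bullet> G (x + t *\<^sub>R v)" for t
    proof -
      have l: "((\<lambda>t. x + t *\<^sub>R v) has_derivative (\<lambda>t. t *\<^sub>R v)) (at t)"
        by (auto intro!: derivative_eq_intros)
      show ?thesis
        using has_derivative_compose[OF l, of p "\<lambda>h. h \<bullet> G (x + t *\<^sub>R v)"] p
        by (simp add: has_grad_hess_def gderiv_def has_field_derivative_def mult_commute_abs)
    qed
    have d2: "DERIV (\<lambda>t. v \<bullet> G (x + t *\<^sub>R v)) 0 :> v \<bullet> A x v"
    proof -
      have l: "((\<lambda>t. x + t *\<^sub>R v) has_derivative (\<lambda>t. t *\<^sub>R v)) (at 0)"
        by (auto intro!: derivative_eq_intros)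
      have "(G has_derivative A x) (at x)" using p by (simp add: has_grad_hess_def)
      then have "((\<lambda>t. G (x + t *\<^sub>R v)) has_derivative (\<lambda>t. A x (t *\<^sub>R v))) (at 0)"
        using has_derivative_compose[OF l, of G "A x"] by simp
      then have "((\<lambda>t. v \<bullet> G (x + t *\<^sub>R v)) has_derivative (\<lambda>t. v \<bullet> A x (t *\<^sub>R v))) (at 0)"
        by (auto intro!: derivative_eq_intros)
      moreover have "linear (A x)" using \<open>(G has_derivative A x) (at x)\<close> has_derivative_linear by blast
      ultimately show ?thesis
        by (simp add: has_field_derivative_def linear_cmul mult_commute_abs)
    qed
    obtain d where d: "d > 0" "\<And>h. 0 < h \<Longrightarrow> h < d \<Longrightarrow> v \<bullet> G (x + h *\<^sub>R v) < 0"
      using DERIV_neg_dec_right[OF d2] neg G0 by auto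
    define h where "h = min (d / 2) (e / (2 * norm v))"
    have h: "0 < h" "h < d" "h * norm v < e"
    proof -
      show "0 < h" "h < d" using d(1) e \<open>v \<noteq> 0\<close> by (auto simp: h_def)
      have "h * norm v \<le> e / (2 * norm v) * norm v" by (intro mult_right_mono) (auto simp: h_def)
      then show "h * norm v < e" using e \<open>v \<noteq> 0\<close> by simp
    qed
    have "p (x + h *\<^sub>R v) < p (x + 0 *\<^sub>R v)"
    proof (rule DERIV_neg_imp_decreasing_open[OF h(1)])
      show "\<exists>y. DERIV (\<lambda>t. p (x + t *\<^sub>R v)) t :> y \<and> y < 0" if "0 < t" "t < h" for t
        using d1 d(2)[of t] that h by fastforce
      show "continuous_on {0..h} (\<lambda>t. p (x + t *\<^sub>R v))"
        using d1 DERIV_atLeastAtMost_imp_continuous_on by blast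
    qed
    moreover have "x + h *\<^sub>R v \<in> ball x e" using h by (simp add: dist_norm)
    ultimately show False using min by fastforce
  qed
qed

lemma laplacian_nonneg_at_local_min:
  assumes p: "real_polynomial_function p" and "e > 0" "\<And>y. y \<in> ball x e \<Longrightarrow> p x \<le> p y"
  shows "laplacian p x \<ge> 0"
proof -
  obtain G A where G: "has_grad_hess p G A" using real_polynomial_has_grad_hess[OF p] .
  show ?thesis
    unfolding has_grad_hess_laplacian[OF G]
    by (intro sum_nonneg second_derivative_at_local_min[OF G assms(2,3)]) auto
qed

lemma real_polynomial_continuous_on: "real_polynomial_function p \<Longrightarrow> continuous_on S p"
  by (simp add: continuous_on_polymonial_function real_polynomial_function_eq)

lemma min_principle:
  fixes p :: "'a::euclidean_space \<Rightarrow> real"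
  assumes p: "real_polynomial_function p" and lap: "\<And>y. laplacian p y < 0"
    and bd: "\<And>y. y \<in> sphere a \<rho> \<Longrightarrow> c \<le> p y" and x: "x \<in> cball a \<rho>"
  shows "c \<le> p x"
proof -
  obtain z where z: "z \<in> cball a \<rho>" "\<And>y. y \<in> cball a \<rho> \<Longrightarrow> p z \<le> p y"
    using continuous_attains_inf[OF compact_cball _ real_polynomial_continuous_on[OF p], of a \<rho>] x
    by blast
  have "z \<notin> ball a \<rho>"
  proof
    assume "z \<in> ball a \<rho>"
    then obtain e where "e > 0" "ball z e \<subseteq> ball a \<rho>" using open_contains_ball open_ball by blast
    then have "laplacian p z \<ge> 0"
      using laplacian_nonneg_at_local_min[OF p, of e z] z(2) by (meson ball_subset_cball subsetD)
    then show False using lap[of z] by simp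
  qed
  then have "z \<in> sphere a \<rho>" using z(1) by (simp add: sphere_def)
  then show ?thesis using bd z(2)[OF x] by fastforce
qed

text \<open>At an interior minimum of \<open>u - p\<close>, a vertical translate of \<open>p\<close> would be an admissible test function for the
  super-solution \<open>u\<close> with Laplacian above \<open>- r\<close>.\<close>

lemma comparison_supersolution:
  fixes p :: "'a::euclidean_space \<Rightarrow> real"
  assumes u: "viscosity_supersolution r \<Omega> u" "continuous_on \<Omega> u" and sub: "cball a \<rho> \<subseteq> \<Omega>"
    and p: "real_polynomial_function p" and lap: "\<And>y. laplacian p y > - r"
    and bd: "\<And>y. y \<in> sphere a \<rho> \<Longrightarrow> p y \<le> u y" and x: "x \<in> cball a \<rho>"
  shows "p x \<le> u x"
proof (rule ccontr)
  assume neg: "\<not> p x \<le> u x"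
  have "continuous_on (cball a \<rho>) (\<lambda>y. u y - p y)"
    using continuous_on_subset[OF u(2) sub] real_polynomial_continuous_on[OF p]
    by (intro continuous_on_diff)
  then obtain z where z: "z \<in> cball a \<rho>" "\<And>y. y \<in> cball a \<rho> \<Longrightarrow> u z - p z \<le> u y - p y"
    using continuous_attains_inf[OF compact_cball, of a \<rho> "\<lambda>y. u y - p y"] x by blast
  have "u z - p z < 0" using z(2)[OF x] neg by simp
  then have "z \<in> ball a \<rho>" using bd[of z] z(1) by (force simp: sphere_def)
  then obtain e where e: "e > 0" "ball z e \<subseteq> ball a \<rho>" using open_contains_ball open_ball by blast
  define \<phi> where "\<phi> = (\<lambda>y. p y + (u z - p z))"
  have \<phi>: "real_polynomial_function \<phi>"
    unfolding \<phi>_def by (intro real_polynomial_function.intros(2,3) p)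
  have sub': "ball z e \<subseteq> \<Omega>" using e(2) sub ball_subset_cball by blast
  have zero: "u z - \<phi> z = 0" by (simp add: \<phi>_def)
  have above: "\<forall>y\<in>ball z e. u y - \<phi> y \<ge> u z - \<phi> z"
  proof
    fix y assume "y \<in> ball z e"
    then have "y \<in> cball a \<rho>" using e(2) ball_subset_cball by blast
    then show "u y - \<phi> y \<ge> u z - \<phi> z" using z(2)[of y] by (simp add: \<phi>_def)
  qed
  have "min (- laplacian \<phi> z - r) (norm (gradient \<phi> z) - 1) \<ge> 0"
    using u(1) e(1) sub' real_polynomial_smooth_on[OF \<phi>] zero above
    unfolding viscosity_supersolution_def by blast
  moreover have "laplacian \<phi> z = laplacian p z"
    unfolding \<phi>_def using laplacian_add[OF p real_polynomial_function.intros(2)]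
    by (simp add: laplacian_const)
  ultimately show False using lap[of z] by simp
qed

section \<open>Approximation by harmonic polynomials on spheres\<close>

text \<open>Homogeneous polynomials only have sums of equal degree; their additive closure is stable under
  products, hence contains all polynomials.\<close>

inductive homogeneous_sum :: "('a::euclidean_space \<Rightarrow> real) \<Rightarrow> bool" where
  base: "homogeneous_poly k p \<Longrightarrow> homogeneous_sum p"
| plus: "homogeneous_sum p \<Longrightarrow> homogeneous_sum q \<Longrightarrow> homogeneous_sum (\<lambda>x. p x + q x)"

lemma homogeneous_sum_mult:
  assumes "homogeneous_sum p" "homogeneous_sum q"
  shows "homogeneous_sum (\<lambda>x. p x * q x)"
  using assms(1)
proof induction
  case (base k p)
  show ?case using assms(2)
  proof induction
    case (base l q) then show ?case
      using homogeneous_sum.base homogeneous_poly_mult \<open>homogeneous_poly k p\<close> by blast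
  next
    case (plus q q') then show ?case using homogeneous_sum.plus by (fastforce simp: distrib_left)
  qed
next
  case (plus p p') then show ?case using homogeneous_sum.plus by (fastforce simp: distrib_right)
qed

lemma real_polynomial_homogeneous_sum:
  fixes p :: "'a::euclidean_space \<Rightarrow> real"
  assumes "real_polynomial_function p" shows "homogeneous_sum p"
  using assms
proof induction
  case (linear f)
  have "f = (\<lambda>x. \<Sum>i\<in>Basis. f i * (x \<bullet> i))"
    by (subst bounded_linear_eq_inner[OF linear]) (simp add: inner_sum_right)
  moreover have "homogeneous_poly 1 (\<lambda>x. \<Sum>i\<in>Basis. f i * (x \<bullet> i))"
    by (intro homogeneous_poly_sum homogeneous_poly_cmult homogeneous_poly_inner finite_Basis)
  ultimately show ?case using homogeneous_sum.base by metis
next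
  case (const c) show ?case by (rule homogeneous_sum.base[OF homogeneous_poly.const])
qed (auto intro: homogeneous_sum.plus homogeneous_sum_mult)

text \<open>Subtract from \<open>p\<close> a polynomial with the same Laplacian that vanishes on the sphere.\<close>

lemma polynomial_dirichlet_origin:
  fixes p :: "'a::euclidean_space \<Rightarrow> real"
  assumes "real_polynomial_function p"
  shows "\<exists>h. real_polynomial_function h \<and> (\<forall>x. laplacian h x = 0) \<and> (\<forall>x. x \<bullet> x = s \<longrightarrow> h x = p x)"
  using real_polynomial_homogeneous_sum[OF assms]
proof induction
  case (base k p)
  have p: "real_polynomial_function p" by (rule homogeneous_poly_real_polynomial[OF base])
  obtain f where f: "real_polynomial_function f" "\<And>x. laplacian f x = (x \<bullet> x) ^ 0 * laplacian p x"
      "\<And>x. x \<bullet> x = s \<Longrightarrow> f x = 0"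
    using homogeneous_dirichlet[OF homogeneous_poly_laplacian(1)[OF base], of 0 s] by blast
  show ?case
    by (intro exI[of _ "\<lambda>x. p x - f x"])
       (simp add: real_polynomial_function_diff[OF p f(1)] laplacian_diff[OF p f(1)] f(2,3))
next
  case (plus p q)
  then obtain h k where hk: "real_polynomial_function h" "\<And>x. laplacian h x = 0" "\<And>x. x \<bullet> x = s \<Longrightarrow> h x = p x"
    "real_polynomial_function k" "\<And>x. laplacian k x = 0" "\<And>x. x \<bullet> x = s \<Longrightarrow> k x = q x"
    by blast
  show ?case
    by (intro exI[of _ "\<lambda>x. h x + k x"])
       (simp add: real_polynomial_function.intros(3)[OF hk(1,4)] laplacian_add[OF hk(1,4)] hk(2,3,5,6))
qed

lemma real_polynomial_translate:
  assumes "real_polynomial_function p"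
  shows "real_polynomial_function (\<lambda>x. p (c + x))"
proof -
  have "polynomial_function (\<lambda>x. c + x)" by (intro polynomial_function_add polynomial_function_const polynomial_function_id)
  then show ?thesis using real_polynomial_function_compose[OF _ assms] by (fastforce simp: o_def)
qed

lemma laplacian_translate:
  assumes "real_polynomial_function p"
  shows "laplacian (\<lambda>x. p (c + x)) x = laplacian p (c + x)"
proof -
  obtain G A where G: "has_grad_hess p G A" using real_polynomial_has_grad_hess[OF assms] .
  show ?thesis
    using has_grad_hess_laplacian[OF has_grad_hess_affine[OF G bounded_linear_ident]] has_grad_hess_laplacian[OF G]
    by simp
qed

lemma harmonic_polynomials_dense:
  fixes g :: "'a::euclidean_space \<Rightarrow> real"
  assumes g: "continuous_on (sphere a \<rho>) g" and "\<epsilon> > 0"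
  shows "\<exists>h. real_polynomial_function h \<and> (\<forall>x. laplacian h x = 0) \<and> (\<forall>x\<in>sphere a \<rho>. \<bar>g x - h x\<bar> < \<epsilon>)"
proof -
  obtain p where p: "real_polynomial_function p" "\<And>x. x \<in> sphere a \<rho> \<Longrightarrow> \<bar>g x - p x\<bar> < \<epsilon>"
    using Stone_Weierstrass_real_polynomial_function[OF compact_sphere g \<open>\<epsilon> > 0\<close>] by blast
  obtain h where h: "real_polynomial_function h" "\<And>x. laplacian h x = 0" "\<And>x. x \<bullet> x = \<rho>\<^sup>2 \<Longrightarrow> h x = p (a + x)"
    using polynomial_dirichlet_origin[OF real_polynomial_translate[OF p(1), of a]] by blast
  have "\<bar>g x - h (- a + x)\<bar> < \<epsilon>" if "x \<in> sphere a \<rho>" for x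
  proof -
    have "norm (- a + x) = \<rho>" using that by (simp add: dist_norm norm_minus_commute)
    then have "(- a + x) \<bullet> (- a + x) = \<rho>\<^sup>2" by (simp only: dot_square_norm)
    then show ?thesis using h(3)[of "- a + x"] p(2)[OF that] by simp
  qed
  then show ?thesis
    using real_polynomial_translate[OF h(1), of "- a"] laplacian_translate[OF h(1), of "- a"] h(2) by auto
qed

section \<open>Replacing a super-solution by a lower polynomial\<close>

text \<open>Let \<open>q y = \<rho>\<^sup>2 - \<bar>y - a\<bar>\<^sup>2\<close>, with Laplacian \<open>- 2 n\<close>, and let \<open>h0\<close> be a harmonic polynomial
  within \<open>\<tau> / 2\<close> of \<open>u\<close> on the sphere. Adding multiples of \<open>q\<close> to \<open>h0 - \<tau> / 2\<close> changes the
  Laplacian but not the boundary values. With Laplacian \<open>1 - r > - r\<close> the result lies below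
  \<open>u\<close> by comparison; lowering it further by \<open>q / (2 n)\<close> gains \<open>\<rho>\<^sup>2 / (2 n)\<close> at the centre and
  leaves the Laplacian at \<open>2 - r\<close>. The gain does not depend on \<open>\<tau>\<close>, which can therefore be taken
  much smaller. The last conclusion only says that \<open>h\<close> is not far below \<open>u\<close> in the ball.\<close>

lemma lowered_replacement:
  fixes u :: "'a::euclidean_space \<Rightarrow> real"
  assumes u: "viscosity_supersolution r \<Omega> u" "continuous_on \<Omega> u" and r: "r \<ge> 0"
    and sub: "cball a \<rho> \<subseteq> \<Omega>" and \<rho>: "\<rho> > 0" and \<tau>: "\<tau> > 0"
  obtains h where "real_polynomial_function h" "\<And>y. laplacian h y = 2 - r"
    "h a \<le> u a - \<rho>\<^sup>2 / (2 * real DIM('a))" "\<And>y. y \<in> sphere a \<rho> \<Longrightarrow> u y - \<tau> \<le> h y"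
    "\<And>y c. y \<in> cball a \<rho> \<Longrightarrow> \<forall>z\<in>sphere a \<rho>. c \<le> u z \<Longrightarrow> c - \<tau> - 2 * \<rho>\<^sup>2 \<le> h y"
proof -
  define n where "n = real DIM('a)"
  have n: "n \<ge> 1" using DIM_positive[where 'a='a] by (simp add: n_def Suc_le_eq)
  have "continuous_on (sphere a \<rho>) u"
    using continuous_on_subset[OF u(2)] sub sphere_cball by blast
  then obtain h0 where h0: "real_polynomial_function h0" "\<And>x. laplacian h0 x = 0"
      "\<And>x. x \<in> sphere a \<rho> \<Longrightarrow> \<bar>u x - h0 x\<bar> < \<tau> / 2"
    using harmonic_polynomials_dense[of a \<rho> u "\<tau> / 2"] \<tau> by auto
  define q where "q = (\<lambda>y. \<rho>\<^sup>2 - (y - a) \<bullet> (y - a))"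
  have q: "real_polynomial_function q"
    unfolding q_def by (intro real_polynomial_function_diff real_polynomial_function.intros(2) real_polynomial_sq)
  have lq: "laplacian q y = - 2 * n" for y
    unfolding q_def
    by (simp add: laplacian_diff[OF real_polynomial_function.intros(2) real_polynomial_sq] laplacian_const
        laplacian_sq n_def)
  define k where "k c d y = (h0 y + c) + d * q y" for c d y
  have k: "real_polynomial_function (k c d)" and lk: "laplacian (k c d) y = - 2 * n * d" for c d y
  proof -
    have 1: "real_polynomial_function (\<lambda>y. h0 y + c)" and 2: "real_polynomial_function (\<lambda>y. d * q y)"
      by (intro real_polynomial_function.intros(2-4) h0(1) q)+
    show "real_polynomial_function (k c d)"
      unfolding k_def by (intro real_polynomial_function.intros(3) 1 2)
    show "laplacian (k c d) y = - 2 * n * d"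
      unfolding k_def laplacian_add[OF 1 2] laplacian_cmult[OF q] lq
        laplacian_add[OF h0(1) real_polynomial_function.intros(2)] h0(2) laplacian_const by simp
  qed
  have qs: "q y = 0" if "y \<in> sphere a \<rho>" for y
    using that by (simp add: q_def dist_norm norm_minus_commute dot_square_norm)
  have qc: "0 \<le> q y" "q y \<le> \<rho>\<^sup>2" if "y \<in> cball a \<rho>" for y
    using that power_mono[of "norm (y - a)" \<rho> 2]
    by (auto simp: q_def dist_norm norm_minus_commute dot_square_norm)
  define h where "h = k (- \<tau> / 2) ((r - 2) / (2 * n))"
  show ?thesis
  proof
    show "real_polynomial_function h" by (simp add: h_def k)
    show "laplacian h y = 2 - r" for y using n by (simp add: h_def lk)
    show "u y - \<tau> \<le> h y" if "y \<in> sphere a \<rho>" for y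
      using h0(3)[OF that] unfolding h_def k_def qs[OF that] by linarith
    show "h a \<le> u a - \<rho>\<^sup>2 / (2 * real DIM('a))"
    proof -
      have "k (- \<tau> / 2) ((r - 1) / (2 * n)) a \<le> u a"
      proof (rule comparison_supersolution[OF u sub k])
        show "laplacian (k (- \<tau> / 2) ((r - 1) / (2 * n))) y > - r" for y
          using n by (simp add: lk)
        show "k (- \<tau> / 2) ((r - 1) / (2 * n)) y \<le> u y" if "y \<in> sphere a \<rho>" for y
          using h0(3)[OF that] unfolding k_def qs[OF that] by linarith
      qed (use \<rho> in simp)
      moreover have "(r - 1) / (2 * n) * \<rho>\<^sup>2 = (r - 2) / (2 * n) * \<rho>\<^sup>2 + \<rho>\<^sup>2 / (2 * n)"
        by (simp add: diff_divide_distrib left_diff_distrib)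
      ultimately show ?thesis by (simp add: h_def k_def q_def n_def)
    qed
    show "c - \<tau> - 2 * \<rho>\<^sup>2 \<le> h y"
      if y: "y \<in> cball a \<rho>" and c: "\<forall>z\<in>sphere a \<rho>. c \<le> u z" for y c
    proof -
      have "c - \<tau> / 2 \<le> k 0 (1 / (2 * n)) y"
      proof (rule min_principle[OF k _ _ y])
        show "laplacian (k 0 (1 / (2 * n))) y < 0" for y using n by (simp add: lk)
        show "c - \<tau> / 2 \<le> k 0 (1 / (2 * n)) z" if "z \<in> sphere a \<rho>" for z
          using h0(3)[OF that] bspec[OF c that] unfolding k_def qs[OF that] by linarith
      qed
      moreover have "1 / (2 * n) * q y = q y / n / 2" by simp
      moreover have "q y / n \<le> \<rho>\<^sup>2" using qc[OF y] n frac_le[of "\<rho>\<^sup>2" "q y" 1 n] by auto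
      moreover have "(r - 2) / (2 * n) * q y \<ge> - (q y / n)"
      proof -
        have "r * q y / (2 * n) \<ge> 0" using r qc[OF y] n by simp
        then show ?thesis by (simp add: diff_divide_distrib left_diff_distrib)
      qed
      moreover have "\<rho>\<^sup>2 \<ge> 0" by simp
      moreover have "c - \<tau> - 2 * w \<le> z + - \<tau> / 2 + d"
        if "c - \<tau> / 2 \<le> z + 0 + b" "b = a / 2" "a \<le> w" "- a \<le> d" "w \<ge> 0" for a b d w z
        using that by linarith
      ultimately show ?thesis unfolding h_def k_def by blast
    qed
  qed
qed

section \<open>Doubling of variables\<close>

definition reflection :: "'a::euclidean_space \<Rightarrow> 'a \<Rightarrow> 'a" where
  "reflection v z = z - (2 * (v \<bullet> z)) *\<^sub>R v"

lemma bounded_linear_reflection: "bounded_linear (reflection v)"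
  unfolding reflection_def
  by (intro bounded_linear_sub bounded_linear_ident bounded_linear_scaleR_const
      bounded_linear_const_mult bounded_linear_inner_right)

lemma reflection_symmetric: "reflection v x \<bullet> y = x \<bullet> reflection v y"
  by (simp add: reflection_def inner_diff_left inner_diff_right inner_commute)

lemma norm_reflection:
  assumes "norm v = 1" shows "norm (reflection v z) = norm z"
proof -
  have "v \<bullet> v = 1" using assms by (simp add: dot_square_norm)
  then have "reflection v z \<bullet> reflection v z = z \<bullet> z"
    by (simp add: reflection_def inner_diff_left inner_diff_right inner_commute algebra_simps)
  then show ?thesis by (simp add: norm_eq_sqrt_inner)
qed

text \<open>The Laplacian is invariant under composition with a reflection. In the expansion
  of the trace, the two cross terms \<open>- 2 (v \<bullet> A v)\<close> cancel \<open>4 (v \<bullet> A v) (v \<bullet> v)\<close>, as \<open>v\<close> is a unit vector.\<close>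

lemma trace_reflection:
  assumes v: "norm v = 1" and A: "linear A"
  shows "(\<Sum>i\<in>Basis. i \<bullet> reflection v (A (reflection v i))) = (\<Sum>i\<in>Basis. i \<bullet> A i)"
proof -
  have vv: "v \<bullet> v = 1" using v by (simp add: dot_square_norm)
  have rep: "(\<Sum>i\<in>Basis. (v \<bullet> i) * (w \<bullet> i)) = v \<bullet> w" for w by (simp add: euclidean_inner[symmetric])
  have A_v: "(\<Sum>i\<in>Basis. (v \<bullet> i) * (v \<bullet> A i)) = v \<bullet> A v"
  proof -
    have "A v = (\<Sum>i\<in>Basis. (v \<bullet> i) *\<^sub>R A i)"
      using linear_sum[OF A] linear_cmul[OF A] euclidean_representation[of v]
      by (metis (no_types, lifting) sum.cong)
    then show ?thesis by (simp add: inner_sum_right)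
  qed
  have "i \<bullet> reflection v (A (reflection v i))
      = i \<bullet> A i - 2 * ((v \<bullet> i) * (A v \<bullet> i)) - 2 * ((v \<bullet> i) * (v \<bullet> A i))
        + 4 * (v \<bullet> A v) * ((v \<bullet> i) * (v \<bullet> i))" for i
    by (simp add: reflection_def linear_diff[OF A] linear_cmul[OF A] inner_diff_right inner_commute algebra_simps)
  then show ?thesis
    by (simp only: sum.distrib sum_subtractf sum_distrib_left[symmetric] rep A_v vv)
qed

lemma has_grad_hess_affine_function: "has_grad_hess (\<lambda>x. b + w \<bullet> x) (\<lambda>x. w) (\<lambda>x h. 0)"
  unfolding has_grad_hess_def gderiv_def
  by (auto intro!: derivative_eq_intros simp: inner_commute)

lemma real_polynomial_affine_function: "real_polynomial_function (\<lambda>x. b + w \<bullet> x)"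
  by (intro real_polynomial_function.intros(2,3) real_polynomial_function.intros(1)[OF bounded_linear_inner_right])

text \<open>The contradiction described at the beginning, with \<open>h\<close> in the role of \<open>u\<close> in the second
  variable: with \<open>v\<close> the unit vector from \<open>y'\<close> to \<open>x'\<close> and \<open>t = \<bar>x' - y'\<bar>\<close>, the point
  \<open>y = y' + reflection v (x - x')\<close> satisfies \<open>x - y = (t + 2 v \<bullet> (x - x')) v\<close>, so that
  \<open>\<bar>x - y\<bar>\<close> is affine in \<open>x\<close> near \<open>x'\<close> and the test function is a polynomial.\<close>

lemma no_interior_maximum:
  fixes u :: "'a::euclidean_space \<Rightarrow> real" and L Q M :: real
  assumes u: "viscosity_subsolution r \<Omega> u" and \<Omega>: "open \<Omega>" "x' \<in> \<Omega>"
    and h: "real_polynomial_function h" "laplacian h y' = 2 - r"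
    and e: "e > 0"
    and max: "\<And>x y. dist x x' < e \<Longrightarrow> dist y y' < e \<Longrightarrow>
        u x - h y - (L * norm (x - y) - Q * (norm (x - y))\<^sup>2) - M * ((x - x0) \<bullet> (x - x0))
        \<le> u x' - h y' - (L * norm (x' - y') - Q * (norm (x' - y'))\<^sup>2) - M * ((x' - x0) \<bullet> (x' - x0))"
    and neq: "x' \<noteq> y'"
    and Q: "8 * Q \<ge> 2 * DIM('a) * M + 3" and M: "M \<ge> 0"
    and L: "L - 2 * Q * norm (x' - y') - 2 * M * norm (x' - x0) > 1"
  shows False
proof -
  define t where "t = norm (x' - y')"
  have t: "t > 0" using neq by (simp add: t_def)
  define v where "v = (1 / t) *\<^sub>R (x' - y')"
  have v: "norm v = 1" "x' - y' = t *\<^sub>R v" using t by (auto simp: v_def t_def)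
  then have vv: "v \<bullet> v = 1" by (simp add: dot_square_norm)
  obtain G A where GA: "has_grad_hess h G A" using real_polynomial_has_grad_hess[OF h(1)] .
  have hG: "(h has_derivative (\<lambda>k. k \<bullet> G y')) (at y')" and GA': "(G has_derivative A y') (at y')"
    using GA by (auto simp: has_grad_hess_def gderiv_def)
  define lam where "lam = L - 2 * Q * t"
  \<comment> \<open>first-order condition in the second variable\<close>
  have G: "G y' = lam *\<^sub>R v"
  proof -
    have dn: "((\<lambda>y. norm (x' - y)) has_derivative (\<lambda>k. - (k \<bullet> v))) (at y')"
    proof -
      have "(norm has_derivative (\<lambda>k. k \<bullet> sgn (x' - y'))) (at (x' - y'))"
        using has_derivative_norm[of "x' - y'"] neq by simp
      moreover have "((\<lambda>y. x' - y) has_derivative (\<lambda>k. - k)) (at y')"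
        by (auto intro!: derivative_eq_intros)
      ultimately have "((\<lambda>y. norm (x' - y)) has_derivative (\<lambda>k. (- k) \<bullet> sgn (x' - y'))) (at y')"
        by (rule has_derivative_compose[rotated])
      moreover have "sgn (x' - y') = v" by (simp add: v_def t_def sgn_div_norm divide_inverse)
      ultimately show ?thesis by simp
    qed
    have "((\<lambda>y. h y + (L * norm (x' - y) - Q * (norm (x' - y))\<^sup>2)) has_derivative
        (\<lambda>k. k \<bullet> G y' + (L * (- (k \<bullet> v)) - Q * (2 * t * (- (k \<bullet> v)))))) (at y')"
      unfolding power2_eq_square
      by (auto intro!: derivative_eq_intros hG dn simp: t_def algebra_simps)
    moreover have "\<forall>y\<in>ball y' e. h y' + (L * norm (x' - y') - Q * (norm (x' - y'))\<^sup>2)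
        \<le> h y + (L * norm (x' - y) - Q * (norm (x' - y))\<^sup>2)"
      using max[of x'] e by (force simp: dist_commute)
    ultimately have "(\<lambda>k. k \<bullet> G y' + (L * (- (k \<bullet> v)) - Q * (2 * t * (- (k \<bullet> v))))) = (\<lambda>k. 0)"
      using differential_zero_maxmin[of y' "ball y' e"] e by simp
    then have "k \<bullet> (G y' - lam *\<^sub>R v) = 0" for k
      by (simp add: lam_def inner_diff_right algebra_simps fun_eq_iff)
    from this[of "G y' - lam *\<^sub>R v"] show ?thesis by simp
  qed
  define s where "s x = (t - 2 * (v \<bullet> x')) + (2 *\<^sub>R v) \<bullet> x" for x
  define p where "p x = h ((y' - reflection v x') + reflection v x)" for x
  define \<psi>0 where "\<psi>0 x = p x + (L * s x + ((- Q) * (s x * s x) + M * ((x - x0) \<bullet> (x - x0))))" for x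
  define \<psi> where "\<psi> x = (u x' - \<psi>0 x') + \<psi>0 x" for x
  have s_poly: "real_polynomial_function s"
    unfolding s_def by (rule real_polynomial_affine_function)
  have p_poly: "real_polynomial_function p"
  proof -
    have "polynomial_function (\<lambda>x. (y' - reflection v x') + reflection v x)"
      by (intro polynomial_function_add polynomial_function_const
          polynomial_function_bounded_linear bounded_linear_reflection)
    then show ?thesis
      unfolding p_def using real_polynomial_function_compose[OF _ h(1)] by (fastforce simp: o_def)
  qed
  have \<psi>_poly: "real_polynomial_function \<psi>"
    unfolding \<psi>_def \<psi>0_def
    by (intro real_polynomial_function.intros(2-4) s_poly p_poly real_polynomial_sq)
  have s_gh: "has_grad_hess s (\<lambda>x. 2 *\<^sub>R v) (\<lambda>x h. 0)"
    unfolding s_def by (rule has_grad_hess_affine_function)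
  note p_gh = has_grad_hess_affine[OF GA bounded_linear_reflection reflection_symmetric,
      of "y' - reflection v x'" v, folded p_def]
  note \<psi>_gh = has_grad_hess_add[OF has_grad_hess_const[of "u x' - \<psi>0 x'"]
      has_grad_hess_add[OF p_gh has_grad_hess_add[OF has_grad_hess_cmult[OF s_gh, of L]
      has_grad_hess_add[OF has_grad_hess_cmult[OF has_grad_hess_mult[OF s_gh s_gh], of "- Q"]
      has_grad_hess_cmult[OF has_grad_hess_sq[of x0], of M]]]], folded \<psi>0_def \<psi>_def]
  have sx': "s x' = t" by (simp add: s_def)
  have rv: "reflection v (lam *\<^sub>R v) = - lam *\<^sub>R v"
    by (simp add: reflection_def vv algebra_simps scaleR_2[symmetric])
  have "gradient \<psi> x' = lam *\<^sub>R v + (2 * M) *\<^sub>R (x' - x0)"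
  proof -
    have "gradient \<psi> x' = - lam *\<^sub>R v + ((L *\<^sub>R 2 *\<^sub>R v
        + (- Q) *\<^sub>R (t *\<^sub>R 2 *\<^sub>R v + t *\<^sub>R 2 *\<^sub>R v)) + M *\<^sub>R 2 *\<^sub>R (x' - x0))"
      unfolding has_grad_hess_gradient[OF \<psi>_gh] by (simp add: sx' G rv)
    also have "L *\<^sub>R 2 *\<^sub>R v + (- Q) *\<^sub>R (t *\<^sub>R 2 *\<^sub>R v + t *\<^sub>R 2 *\<^sub>R v) = (2 * lam) *\<^sub>R v"
      by (simp only: scaleR_scaleR scaleR_add_left[symmetric]) (simp add: lam_def)
    also have "- lam *\<^sub>R v + ((2 * lam) *\<^sub>R v + M *\<^sub>R 2 *\<^sub>R (x' - x0))
        = (- lam + 2 * lam) *\<^sub>R v + (M * 2) *\<^sub>R (x' - x0)"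
      by (simp only: scaleR_add_left scaleR_scaleR add.assoc)
    finally show ?thesis by (simp add: mult.commute)
  qed
  then have grad: "norm (gradient \<psi> x') > 1"
  proof -
    have "norm (lam *\<^sub>R v + (2 * M) *\<^sub>R (x' - x0)) \<ge> norm (lam *\<^sub>R v) - norm ((2 * M) *\<^sub>R (x' - x0))"
      by (rule norm_diff_ineq)
    moreover have "norm (lam *\<^sub>R v) \<ge> lam" using v by simp
    moreover have "norm ((2 * M) *\<^sub>R (x' - x0)) = 2 * M * norm (x' - x0)" using M by simp
    ultimately show ?thesis
      using L unfolding \<open>gradient \<psi> x' = _\<close> lam_def t_def by linarith
  qed
  have lap: "laplacian \<psi> x' \<le> - r - 1"
  proof -
    have tr: "(\<Sum>i\<in>Basis. i \<bullet> reflection v (A y' (reflection v i))) = 2 - r"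
      using trace_reflection[OF v(1) has_derivative_linear[OF GA']] h(2) has_grad_hess_laplacian[OF GA, of y'] by simp
    have "(\<Sum>i\<in>Basis. (i \<bullet> v) * (i \<bullet> v)) = 1"
      using vv by (simp add: euclidean_inner[of v v] inner_commute)
    moreover have "laplacian \<psi> x' = (\<Sum>i\<in>Basis. i \<bullet> reflection v (A y' (reflection v i))
        + (2 * M + (- 8 * Q) * ((i \<bullet> v) * (i \<bullet> v))))"
      unfolding has_grad_hess_laplacian[OF \<psi>_gh]
      by (intro sum.cong refl) (simp add: inner_add_right inner_diff_right)
    ultimately have "laplacian \<psi> x' = (2 - r) + (2 * M * DIM('a) + (- 8 * Q) * 1)"
      by (simp only: sum.distrib tr sum_distrib_left[symmetric] sum_constant) simp
    then show ?thesis using Q by (simp add: mult.commute mult.left_commute)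
  qed
  obtain d where d: "d > 0" "ball x' d \<subseteq> \<Omega>" using \<Omega> open_contains_ball by blast
  define \<delta> where "\<delta> = Min {d, e, t / 2}"
  have \<delta>: "\<delta> > 0" "\<delta> \<le> d" "\<delta> \<le> e" "\<delta> \<le> t / 2" using d e t by (auto simp: \<delta>_def)
  have zero: "u x' - \<psi> x' = 0" by (simp add: \<psi>_def)
  have touch: "\<forall>x\<in>ball x' \<delta>. u x - \<psi> x \<le> u x' - \<psi> x'"
  proof
    fix x assume "x \<in> ball x' \<delta>"
    then have x: "norm (x - x') < \<delta>" by (simp add: dist_norm norm_minus_commute)
    define y where "y = (y' - reflection v x') + reflection v x"
    have y: "y - y' = reflection v (x - x')"
      by (simp add: y_def linear_diff[OF bounded_linear.linear[OF bounded_linear_reflection]])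
    then have "dist y y' < e" using x \<delta> by (simp add: dist_norm norm_reflection[OF v(1)])
    moreover have "x - y = s x *\<^sub>R v"
    proof -
      have "x - y = (x' - y') + ((x - x') - (y - y'))" by simp
      also have "\<dots> = s x *\<^sub>R v"
        unfolding y v(2) by (simp add: reflection_def s_def inner_diff_right algebra_simps)
      finally show ?thesis .
    qed
    moreover have "s x \<ge> 0"
    proof -
      have "\<bar>v \<bullet> (x - x')\<bar> \<le> norm (x - x')" using Cauchy_Schwarz_ineq2[of v "x - x'"] v(1) by simp
      then show ?thesis using x \<delta>(4) by (simp add: s_def inner_diff_right abs_le_iff)
    qed
    moreover have "p x = h y" "p x' = h y'" by (simp_all add: p_def y_def)
    ultimately show "u x - \<psi> x \<le> u x' - \<psi> x'"
      using max[of x y] x \<delta> v(1) by (simp add: dist_norm \<psi>_def \<psi>0_def sx' t_def[symmetric] power2_eq_square)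
  qed
  have "ball x' \<delta> \<subseteq> \<Omega>" using d(2) \<delta>(2) subset_ball by blast
  then have "min (- laplacian \<psi> x' - r) (norm (gradient \<psi> x') - 1) \<le> 0"
    using u \<delta>(1) real_polynomial_smooth_on[OF \<psi>_poly] zero touch
    unfolding viscosity_subsolution_def by blast
  then show False using grad lap by linarith
qed


text \<open>The constants are forced by \<open>M (R / 2)\<^sup>2 = 2 N\<close> (no positive maximum with
  \<open>\<bar>x - x0\<bar> = R / 2\<close>), by \<open>8 Q = 2 n M + 3\<close> (the Laplacian of the test function is \<open>- r - 1\<close>), and by
  \<open>L = 2 + Q R + M R + 4 N / R\<close>, where the last term gives \<open>\<phi> (R / 2) \<ge> 2 N\<close> and the others a slope of
  the test function of at least \<open>2\<close>.\<close>

lemma doubling_estimate: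
  fixes u :: "'a::euclidean_space \<Rightarrow> real" and N :: real
  assumes \<Omega>: "open \<Omega>" and r: "r \<ge> 0" and u: "viscosity_solution r \<Omega> u"
    and R: "R > 0" "cball x0 R \<subseteq> \<Omega>" and N: "\<And>x. x \<in> cball x0 R \<Longrightarrow> \<bar>u x\<bar> \<le> N"
    and y: "dist x0 y \<le> R / 2"
  shows "u x0 - u y \<le> (2 + 3 * R / 8 + (12 + 2 * DIM('a)) * N / R) * dist x0 y"
proof (rule ccontr)
  assume neg: "\<not> ?thesis"
  define n where "n = real DIM('a)"
  have n: "n \<ge> 1" using DIM_positive[where 'a='a] by (simp add: n_def Suc_le_eq)
  have N0: "N \<ge> 0" using N[of x0] R by force
  define M where "M = 8 * N / R\<^sup>2"
  define Q where "Q = (2 * n * M + 3) / 8"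
  define L where "L = 2 + 3 * R / 8 + (12 + 2 * n) * N / R"
  define \<phi> where "\<phi> t = L * t - Q * t\<^sup>2" for t
  have M: "M \<ge> 0" and Q: "Q \<ge> 0" using N0 R n by (auto simp: M_def Q_def)
  have MR: "M * (R / 2)\<^sup>2 = 2 * N" using R by (simp add: M_def power_divide)
  have L_eq: "L = 2 + Q * R + M * R + 4 * (N / R)"
  proof -
    have "M * R = 8 * (N / R)" using R by (simp add: M_def power2_eq_square)
    moreover have "Q * R = n * (M * R) / 4 + 3 * R / 8" by (simp add: Q_def field_simps)
    moreover have "(12 + 2 * n) * N / R = 12 * (N / R) + 2 * (n * (N / R))"
      by (simp add: add_divide_distrib distrib_right)
    ultimately show ?thesis by (simp add: L_def)
  qed
  have NR: "N / R \<ge> 0" using N0 R by simp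
  have Qt: "Q * t \<le> Q * R / 2" if "t \<le> R / 2" for t
    using mult_left_mono[OF that Q] by simp
  have \<phi>0: "0 \<le> \<phi> t" if "0 \<le> t" "t \<le> R / 2" for t
  proof -
    have "Q * R \<ge> 0" "M * R \<ge> 0" using Q M R by auto
    then have "L - Q * t \<ge> 0" using L_eq NR Qt[OF that(2)] by linarith
    then have "t * (L - Q * t) \<ge> 0" using that by simp
    then show ?thesis by (simp add: \<phi>_def power2_eq_square algebra_simps)
  qed
  have \<phi>R: "2 * N \<le> \<phi> (R / 2)"
  proof -
    have "Q * R \<ge> 0" "M * R \<ge> 0" using Q M R by auto
    then have "L - Q * (R / 2) \<ge> 4 * (N / R)" using L_eq NR Qt[of "R / 2"] by linarith
    then have "(R / 2) * (4 * (N / R)) \<le> (R / 2) * (L - Q * (R / 2))"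
      using R by (intro mult_left_mono) auto
    then show ?thesis using R by (simp add: \<phi>_def power2_eq_square algebra_simps)
  qed
  have slope: "L - 2 * Q * t - 2 * M * s > 1" if "t \<le> R / 2" "s \<le> R / 2" for s t
    using Qt[OF that(1)] mult_left_mono[OF that(2) M] L_eq NR by linarith
  have cu: "continuous_on \<Omega> u" using u by (simp add: viscosity_solution_def)
  define D where "D = {z. fst z \<in> cball x0 (R / 2) \<and> norm (fst z - snd z) \<le> R / 2}"
  have D_sub: "fst z \<in> cball x0 R" "snd z \<in> cball x0 R" if "z \<in> D" for z
    using that R dist_triangle[of x0 "snd z" "fst z"] by (auto simp: D_def dist_norm)
  define F where "F w z = u (fst z) - w (snd z) - \<phi> (norm (fst z - snd z))
    - M * ((fst z - x0) \<bullet> (fst z - x0))" for w z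
  have F_cont: "continuous_on S (F w)"
    if "fst ` S \<subseteq> \<Omega>" "continuous_on T w" "snd ` S \<subseteq> T" for S w T
    unfolding F_def \<phi>_def
    by (intro continuous_intros continuous_on_compose2[OF cu, of _ fst] continuous_on_compose2[OF that(2), of _ snd] that)
  have D_compact: "compact D"
  proof -
    have "D = (cball x0 (R / 2) \<times> cball x0 R) \<inter> {z. norm (fst z - snd z) \<le> R / 2}"
      using D_sub by (auto simp: D_def)
    moreover have "closed {z :: 'a \<times> 'a. norm (fst z - snd z) \<le> R / 2}"
      by (intro closed_Collect_le continuous_intros)
    ultimately show ?thesis by (simp add: compact_Int_closed compact_Times)
  qed
  have interior: "norm (fst z - x0) < R / 2 \<and> norm (fst z - snd z) < R / 2 \<and> fst z \<noteq> snd z"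
    if z: "z \<in> D" and pos: "F u z > 0" for z
  proof -
    have z1: "norm (fst z - x0) \<le> R / 2" and z2: "norm (fst z - snd z) \<le> R / 2"
      using z by (auto simp: D_def dist_norm norm_minus_commute)
    have osc: "u (fst z) - u (snd z) \<le> 2 * N" using N[OF D_sub(1)[OF z]] N[OF D_sub(2)[OF z]] by linarith
    have pM: "M * ((fst z - x0) \<bullet> (fst z - x0)) \<ge> 0" using M by simp
    have p\<phi>: "\<phi> (norm (fst z - snd z)) \<ge> 0" using z2 by (intro \<phi>0) auto
    have "norm (fst z - x0) \<noteq> R / 2"
    proof
      assume "norm (fst z - x0) = R / 2"
      then have "M * ((fst z - x0) \<bullet> (fst z - x0)) = 2 * N" using MR by (simp only: dot_square_norm)
      then show False using pos osc p\<phi> by (simp add: F_def)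
    qed
    moreover have "norm (fst z - snd z) \<noteq> R / 2"
      using pos osc pM \<phi>R by (auto simp: F_def)
    moreover have "fst z \<noteq> snd z"
      using pos pM by (auto simp: F_def \<phi>_def)
    ultimately show ?thesis using z1 z2 by linarith
  qed
  have start: "(x0, y) \<in> D" "F u (x0, y) > 0"
  proof -
    show "(x0, y) \<in> D" using y R by (simp add: D_def dist_norm)
    have "Q * (norm (x0 - y))\<^sup>2 \<ge> 0" using Q by simp
    then show "F u (x0, y) > 0" using neg by (simp add: F_def \<phi>_def L_def n_def dist_norm)
  qed
  have "continuous_on D (F u)"
    by (rule F_cont[OF _ cu]) (use D_sub R in blast)+
  then obtain a where a: "a \<in> D" "\<And>z. z \<in> D \<Longrightarrow> F u z \<le> F u a"
    using continuous_attains_sup[OF D_compact] start(1) by blast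
  define m where "m = F u a"
  have m: "m > 0" using a(2)[OF start(1)] start(2) by (simp add: m_def)
  define b where "b = snd a"
  have b: "b \<in> ball x0 R"
  proof -
    have "norm (b - x0) \<le> norm (fst a - x0) + norm (fst a - b)"
      using norm_triangle_ineq4[of "fst a - x0" "fst a - b"] by simp
    then show ?thesis
      using interior[OF a(1)] m by (simp add: m_def b_def dist_norm norm_minus_commute)
  qed
  obtain \<rho>0 where \<rho>0: "\<rho>0 > 0" "cball b \<rho>0 \<subseteq> ball x0 R"
    using b open_contains_cball open_ball by blast
  have "b \<in> \<Omega>" using b R ball_subset_cball by blast
  then obtain \<rho>1 where \<rho>1: "\<rho>1 > 0" "\<And>z. z \<in> \<Omega> \<Longrightarrow> dist z b < \<rho>1 \<Longrightarrow> dist (u z) (u b) < m / 8"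
    using cu m unfolding continuous_on_iff by (metis zero_less_divide_iff zero_less_numeral)
  \<comment> \<open>So small that replacing \<open>u\<close> by \<open>h\<close> on \<open>cball b \<rho>\<close> cannot create a maximum with \<open>F u \<le> 0\<close>.\<close>
  define \<rho> where "\<rho> = Min {\<rho>0, \<rho>1 / 2, 1, m / 8}"
  have \<rho>: "\<rho> > 0" "\<rho> \<le> \<rho>0" "\<rho> \<le> \<rho>1 / 2" "\<rho> \<le> 1" "\<rho> \<le> m / 8"
    using \<rho>0 \<rho>1 m by (auto simp: \<rho>_def)
  have \<rho>2: "\<rho>\<^sup>2 \<le> m / 8" using \<rho> mult_mono[of \<rho> 1 \<rho> "m / 8"] by (simp add: power2_eq_square)
  have sub: "cball b \<rho> \<subseteq> cball x0 R" using \<rho>0(2) \<rho>(2) by (meson ball_subset_cball subset_cball subset_trans)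
  have osc: "\<bar>u z - u b\<bar> < m / 8" if "z \<in> cball b \<rho>" for z
  proof -
    have "z \<in> \<Omega>" using that sub R(2) by blast
    moreover have "dist z b < \<rho>1" using that \<rho>(3) \<rho>1(1) by (simp add: dist_commute)
    ultimately show ?thesis using \<rho>1(2) by (simp add: dist_real_def)
  qed
  define \<tau> where "\<tau> = \<rho>\<^sup>2 / (4 * n)"
  have \<tau>: "\<tau> > 0" "\<tau> < \<rho>\<^sup>2 / (2 * n)" "\<tau> \<le> m / 8"
  proof -
    have "\<rho>\<^sup>2 > 0" using \<rho> by simp
    then show "\<tau> > 0" "\<tau> < \<rho>\<^sup>2 / (2 * n)" using n by (auto simp: \<tau>_def field_simps)
    have "\<tau> \<le> \<rho>\<^sup>2 / 1" unfolding \<tau>_def using n by (intro divide_left_mono) auto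
    then show "\<tau> \<le> m / 8" using \<rho>2 by simp
  qed
  have sup: "viscosity_supersolution r \<Omega> u" and subs: "viscosity_subsolution r \<Omega> u"
    using u by (auto simp: viscosity_solution_def)
  obtain h where h: "real_polynomial_function h" "\<And>y. laplacian h y = 2 - r"
    "h b \<le> u b - \<rho>\<^sup>2 / (2 * n)" "\<And>y. y \<in> sphere b \<rho> \<Longrightarrow> u y - \<tau> \<le> h y"
    "\<And>y c. y \<in> cball b \<rho> \<Longrightarrow> \<forall>z\<in>sphere b \<rho>. c \<le> u z \<Longrightarrow> c - \<tau> - 2 * \<rho>\<^sup>2 \<le> h y"
    by (rule lowered_replacement[OF sup cu r subset_trans[OF sub R(2)] \<rho>(1) \<tau>(1), folded n_def], rule that)
  define D' where "D' = D \<inter> {z. snd z \<in> cball b \<rho>}"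
  have D'_compact: "compact D'"
  proof -
    have "{z. snd z \<in> cball b \<rho>} = UNIV \<times> cball b \<rho>" by auto
    then show ?thesis unfolding D'_def using D_compact closed_Times[OF closed_UNIV closed_cball]
      by (metis compact_Int_closed)
  qed
  have aD': "a \<in> D'" using a(1) \<rho>(1) by (simp add: D'_def b_def)
  have "continuous_on D' (F h)"
    by (rule F_cont[OF _ real_polynomial_continuous_on[OF h(1), of UNIV]]) (use D_sub R D'_def in blast)+
  then obtain z where z: "z \<in> D'" "\<And>w. w \<in> D' \<Longrightarrow> F h w \<le> F h z"
    using continuous_attains_sup[OF D'_compact] aD' by blast
  have zD: "z \<in> D" and zb: "snd z \<in> cball b \<rho>" using z(1) by (auto simp: D'_def)
  have Fhu: "F h w = F u w + (u (snd w) - h (snd w))" for w by (simp add: F_def)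
  have big: "F h z \<ge> m + \<rho>\<^sup>2 / (2 * n)" using z(2)[OF aD'] h(3) by (simp add: Fhu[of a] m_def b_def)
  have "\<forall>w\<in>sphere b \<rho>. u (snd z) - m / 4 \<le> u w"
  proof
    fix w assume "w \<in> sphere b \<rho>"
    then have "w \<in> cball b \<rho>" by simp
    from osc[OF this] osc[OF zb] show "u (snd z) - m / 4 \<le> u w" by linarith
  qed
  then have "u (snd z) - m / 4 - \<tau> - 2 * \<rho>\<^sup>2 \<le> h (snd z)" by (rule h(5)[OF zb])
  moreover have "\<rho>\<^sup>2 / (2 * n) > 0" using \<tau> by linarith
  ultimately have pos: "F u z > 0" using big Fhu[of z] \<rho>2 \<tau>(3) m by linarith
  have z_int: "norm (fst z - x0) < R / 2" "norm (fst z - snd z) < R / 2" "fst z \<noteq> snd z"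
    using interior[OF zD pos] by auto
  \<comment> \<open>On the sphere the replacement gains at most \<open>\<tau>\<close>, less than it gains at the maximum point of \<open>F u\<close>.\<close>
  have "snd z \<notin> sphere b \<rho>"
    using h(4)[of "snd z"] big Fhu[of z] a(2)[OF zD] \<tau>(2) unfolding m_def by linarith
  then have zb': "dist b (snd z) < \<rho>" using zb by (simp add: less_le)
  define e where "e = Min {R / 2 - norm (fst z - x0), (R / 2 - norm (fst z - snd z)) / 2, \<rho> - dist b (snd z)}"
  have e: "e > 0" "e \<le> R / 2 - norm (fst z - x0)" "e \<le> (R / 2 - norm (fst z - snd z)) / 2" "e \<le> \<rho> - dist b (snd z)"
  proof -
    show "e > 0" using z_int zb' by (simp add: e_def)
  qed (unfold e_def, (rule Min_le; simp)+)
  show False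
  proof (rule no_interior_maximum[OF subs \<Omega> _ h(1,2) e(1) _ z_int(3), where M = M and Q = Q and L = L])
    show "fst z \<in> \<Omega>" using D_sub[OF zD] R by blast
    show "8 * Q \<ge> 2 * DIM('a) * M + 3" by (simp add: Q_def n_def)
    show "M \<ge> 0" by (rule M)
    show "L - 2 * Q * norm (fst z - snd z) - 2 * M * norm (fst z - x0) > 1"
      using z_int by (intro slope) auto
    fix x y assume xy: "dist x (fst z) < e" "dist y (snd z) < e"
    have "(x, y) \<in> D'"
    proof -
      have "dist x0 x \<le> dist x (fst z) + norm (fst z - x0)"
        using dist_triangle[of x0 x "fst z"] by (simp add: dist_commute dist_norm norm_minus_commute)
      moreover have "dist b y \<le> dist y (snd z) + dist b (snd z)"
        using dist_triangle[of b y "snd z"] by (simp add: dist_commute)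
      moreover have "norm (x - y) \<le> dist x (fst z) + norm (fst z - snd z) + dist y (snd z)"
      proof -
        have "x - y = (x - fst z) + (fst z - snd z) - (y - snd z)" by simp
        then show ?thesis
          by (metis (no_types, lifting) add_mono dist_norm norm_triangle_ineq norm_triangle_le_diff order_refl)
      qed
      ultimately show ?thesis using xy e by (simp add: D'_def D_def)
    qed
    from z(2)[OF this]
    show "u x - h y - (L * norm (x - y) - Q * (norm (x - y))\<^sup>2) - M * ((x - x0) \<bullet> (x - x0))
        \<le> u (fst z) - h (snd z) - (L * norm (fst z - snd z) - Q * (norm (fst z - snd z))\<^sup>2)
          - M * ((fst z - x0) \<bullet> (fst z - x0))"
      by (simp add: F_def \<phi>_def)
  qed
qed

section \<open>The gradient of a viscosity solution\<close>

lemma locally_lipschitz_viscosity_solution: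
  fixes u :: "'a::euclidean_space \<Rightarrow> real"
  assumes \<Omega>: "open \<Omega>" and r: "r \<ge> 0" and u: "viscosity_solution r \<Omega> u"
  shows "locally_lipschitz_on \<Omega> u"
  unfolding locally_lipschitz_on_def
proof
  fix x assume "x \<in> \<Omega>"
  then obtain S where S: "S > 0" "cball x S \<subseteq> \<Omega>" using \<Omega> open_contains_cball by blast
  define R where "R = S / 2"
  have R: "R > 0" using S by (simp add: R_def)
  have "continuous_on (cball x S) u"
    by (rule continuous_on_subset[OF _ S(2)]) (use u in \<open>simp add: viscosity_solution_def\<close>)
  then have "bounded (u ` cball x S)"
    by (intro compact_imp_bounded compact_continuous_image compact_cball)
  then obtain N where "\<forall>v\<in>u ` cball x S. norm v \<le> N"
    unfolding bounded_iff by blast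
  then have N: "\<bar>u y\<bar> \<le> N" if "y \<in> cball x S" for y using that by fastforce
  have N0: "N \<ge> 0" using N[of x] S by force
  define K where "K = 2 + 3 * R / 8 + (12 + 2 * DIM('a)) * N / R"
  have est: "u z - u y \<le> K * dist z y" if "z \<in> ball x (R / 4)" "y \<in> ball x (R / 4)" for z y
    unfolding K_def
  proof (rule doubling_estimate[OF \<Omega> r u R])
    have zS: "cball z R \<subseteq> cball x S"
      using that(1) R by (simp add: R_def cball_subset_cball_iff dist_commute)
    then show "cball z R \<subseteq> \<Omega>" using S by blast
    show "\<bar>u w\<bar> \<le> N" if "w \<in> cball z R" for w using zS N that by blast
    show "dist z y \<le> R / 2" using that dist_triangle[of z y x] by (simp add: dist_commute)
  qed
  have "K-lipschitz_on (ball x (R / 4) \<inter> \<Omega>) u"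
  proof (rule lipschitz_onI)
    show "K \<ge> 0" using N0 R by (simp add: K_def)
    show "dist (u z) (u y) \<le> K * dist z y" if "z \<in> ball x (R / 4) \<inter> \<Omega>" "y \<in> ball x (R / 4) \<inter> \<Omega>" for z y
      using est[of z y] est[of y z] that by (simp add: dist_real_def dist_commute abs_le_iff)
  qed
  then show "\<exists>\<rho>>0. \<exists>L. L-lipschitz_on (ball x \<rho> \<inter> \<Omega>) u"
    using R by (intro exI[of _ "R / 4"]) auto
qed

lemma norm_gradient_le:
  fixes u :: "'a::euclidean_space \<Rightarrow> real"
  assumes \<delta>: "\<delta> > 0" and K: "K \<ge> 0" and le: "\<And>y. dist x y \<le> \<delta> \<Longrightarrow> u x - u y \<le> K * dist x y"
  shows "norm (gradient u x) \<le> K"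
proof (cases "u differentiable (at x)")
  case False then show ?thesis using K by (simp add: gradient_def)
next
  case True
  then obtain D where D: "GDERIV u x :> D" using differentiable_imp_gderiv by blast
  show ?thesis unfolding gradient_eqI[OF D]
  proof (rule ccontr)
    assume neg: "\<not> norm D \<le> K"
    then have D0: "norm D > 0" using K by linarith
    have l: "((\<lambda>t. x - t *\<^sub>R D) has_derivative (\<lambda>t. - (t *\<^sub>R D))) (at 0)"
      by (auto intro!: derivative_eq_intros)
    have "((\<lambda>t. u (x - t *\<^sub>R D)) has_derivative (\<lambda>t. - (t *\<^sub>R D) \<bullet> D)) (at 0)"
      using has_derivative_compose[OF l, of u "\<lambda>h. h \<bullet> D"] D by (simp add: gderiv_def)
    then have "DERIV (\<lambda>t. u (x - t *\<^sub>R D)) 0 :> - (D \<bullet> D)"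
      by (rule has_derivative_imp_has_field_derivative) (simp add: mult.commute)
    then have "DERIV (\<lambda>t. u (x - t *\<^sub>R D) + K * norm D * t) 0 :> - (D \<bullet> D) + K * norm D"
      by (auto intro!: derivative_eq_intros)
    moreover have "- (D \<bullet> D) + K * norm D < 0"
      using neg D0 by (simp add: dot_square_norm power2_eq_square)
    ultimately have "\<exists>d>0. \<forall>h>0. h < d \<longrightarrow>
        u (x - 0 *\<^sub>R D) + K * norm D * 0 > u (x - (0 + h) *\<^sub>R D) + K * norm D * (0 + h)"
      by (rule DERIV_neg_dec_right)
    then obtain d where d: "d > 0"
      "\<And>t. 0 < t \<Longrightarrow> t < d \<Longrightarrow> u (x - t *\<^sub>R D) + K * norm D * t < u x"
      by auto
    define t where "t = min (d / 2) (\<delta> / norm D)"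
    have t: "0 < t" "t < d" using d(1) \<delta> D0 by (auto simp: t_def)
    have "t * norm D \<le> \<delta>"
    proof -
      have "t * norm D \<le> \<delta> / norm D * norm D" by (intro mult_right_mono) (auto simp: t_def)
      then show ?thesis using D0 by simp
    qed
    then have "u x - u (x - t *\<^sub>R D) \<le> K * (t * norm D)"
      using le[of "x - t *\<^sub>R D"] t by (simp add: dist_norm)
    then show False using d(2)[OF t] by (simp add: mult.commute mult.left_commute)
  qed
qed

text \<open>The essential supremum is infinite for non-measurable functions, so measurability of the gradient has
  to be proved. The only candidate for the gradient is the Borel function \<open>g\<close> whose components are the
  limits of difference quotients. By continuity of \<open>u\<close>, differentiability with gradient \<open>g x\<close> can be
  tested on a countable dense set of increments, which exhibits the set of differentiability as Borel.\<close>

lemma borel_measurable_gradient: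
  fixes u :: "'a::euclidean_space \<Rightarrow> real"
  assumes \<Omega>: "open \<Omega>" and u: "continuous_on \<Omega> u" and S: "open S" "S \<subseteq> \<Omega>"
  shows "gradient u \<in> borel_measurable (lebesgue_on S)"
proof -
  define w where "w x = (if x \<in> \<Omega> then u x else 0)" for x
  have w_meas [measurable]: "w \<in> borel_measurable borel"
    unfolding w_def using \<Omega> u
    by (intro borel_measurable_continuous_on_if) auto
  obtain H :: "'a set" where H: "countable H" "\<And>X. open X \<Longrightarrow> X \<noteq> {} \<Longrightarrow> \<exists>h\<in>H. h \<in> X"
    using countable_dense_setE by blast
  have "H \<noteq> {}" using H(2)[of UNIV] by auto
  define \<eta> where "\<eta> = from_nat_into H"
  have \<eta>: "range \<eta> = H" using range_from_nat_into[OF \<open>H \<noteq> {}\<close> H(1)] by (simp add: \<eta>_def)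
  define g where "g x = (\<Sum>i\<in>Basis. lim (\<lambda>k. (w (x + inverse (real (Suc k)) *\<^sub>R i) - w x) * real (Suc k)) *\<^sub>R i)" for x
  have shift [measurable]: "(\<lambda>x. w (x + h)) \<in> borel_measurable borel" for h
    by measurable
  have g_meas [measurable]: "g \<in> borel_measurable borel"
    unfolding g_def by measurable
  define P where "P x \<longleftrightarrow> (\<forall>k. \<exists>j. \<forall>l. norm (\<eta> l) < inverse (real (Suc j)) \<longrightarrow>
      \<bar>w (x + \<eta> l) - w x - \<eta> l \<bullet> g x\<bar> \<le> inverse (real (Suc k)) * norm (\<eta> l))" for x
  have P_meas [measurable]: "Measurable.pred borel P"
    unfolding P_def by measurable
  have P1: "GDERIV u x :> g x" if x: "x \<in> \<Omega>" and Px: "P x" for x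
  proof -
    obtain d where d: "d > 0" "ball x d \<subseteq> \<Omega>" using \<Omega> x open_contains_ball by blast
    have "(w has_derivative (\<lambda>h. h \<bullet> g x)) (at x)"
      unfolding has_derivative_at_alt
    proof (intro conjI allI impI bounded_linear_inner_left)
      fix e :: real assume "e > 0"
      then obtain k where k: "inverse (real (Suc k)) < e" using reals_Archimedean by blast
      obtain j where j: "\<And>l. norm (\<eta> l) < inverse (real (Suc j)) \<Longrightarrow>
          \<bar>w (x + \<eta> l) - w x - \<eta> l \<bullet> g x\<bar> \<le> inverse (real (Suc k)) * norm (\<eta> l)"
        using Px unfolding P_def by blast
      define \<delta> where "\<delta> = min d (inverse (real (Suc j)))"
      have \<delta>: "\<delta> > 0" "\<delta> \<le> d" "\<delta> \<le> inverse (real (Suc j))" using d by (auto simp: \<delta>_def)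
      define F where "F h = inverse (real (Suc k)) * norm h - \<bar>w (x + h) - w x - h \<bullet> g x\<bar>" for h
      have shift_in: "x + h \<in> \<Omega>" if "h \<in> ball 0 \<delta>" for h
        using that \<delta>(2) d(2) by (auto simp: subset_iff dist_norm)
      have "continuous_on (ball 0 \<delta>) (\<lambda>h. w (x + h))"
      proof -
        have "continuous_on (ball 0 \<delta>) (\<lambda>h. u (x + h))"
        proof (rule continuous_on_compose2[OF u])
          show "continuous_on (ball 0 \<delta>) (\<lambda>h. x + h)" by (intro continuous_intros)
          show "(\<lambda>h. x + h) ` ball 0 \<delta> \<subseteq> \<Omega>" by (rule image_subsetI) (rule shift_in)
        qed
        then show ?thesis by (rule continuous_on_eq) (use shift_in in \<open>simp add: w_def\<close>)
      qed
      then have "continuous_on (ball 0 \<delta>) F" unfolding F_def by (intro continuous_intros)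
      then have op: "open (ball 0 \<delta> \<inter> F -` {..<0})"
        by (intro continuous_open_preimage) auto
      have F0: "F h \<ge> 0" if "h \<in> ball 0 \<delta>" for h
      proof (rule ccontr)
        assume "\<not> F h \<ge> 0"
        then have "ball 0 \<delta> \<inter> F -` {..<0} \<noteq> {}" using that by auto
        then obtain l where "\<eta> l \<in> ball 0 \<delta> \<inter> F -` {..<0}" using H(2)[OF op] \<eta> by (metis imageE)
        then show False using j[of l] \<delta>(3) by (simp add: F_def)
      qed
      have "\<bar>w y - w x - (y - x) \<bullet> g x\<bar> \<le> e * norm (y - x)" if "norm (y - x) < \<delta>" for y
      proof -
        have "inverse (real (Suc k)) * norm (y - x) \<le> e * norm (y - x)"
          using k by (intro mult_right_mono) auto
        then show ?thesis using F0[of "y - x"] that unfolding F_def by (simp add: norm_minus_commute)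
      qed
      then show "\<exists>d>0. \<forall>y. norm (y - x) < d \<longrightarrow> norm (w y - w x - (y - x) \<bullet> g x) \<le> e * norm (y - x)"
        using \<delta>(1) by auto
    qed
    then have "(u has_derivative (\<lambda>h. h \<bullet> g x)) (at x)"
      by (rule has_derivative_transform_within_open[OF _ \<Omega> x]) (simp add: w_def)
    then show ?thesis by (simp add: gderiv_def)
  qed
  have P2: "P x" if x: "x \<in> \<Omega>" and D: "GDERIV u x :> D" for x D
  proof -
    have wD: "(w has_derivative (\<lambda>h. h \<bullet> D)) (at x)"
      using D unfolding gderiv_def
      by (rule has_derivative_transform_within_open[OF _ \<Omega> x]) (simp add: w_def)
    have "lim (\<lambda>k. (w (x + inverse (real (Suc k)) *\<^sub>R i) - w x) * real (Suc k)) = i \<bullet> D" for i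
    proof (rule limI)
      have l: "((\<lambda>t. x + t *\<^sub>R i) has_derivative (\<lambda>t. t *\<^sub>R i)) (at 0)"
        by (auto intro!: derivative_eq_intros)
      have "((\<lambda>t. w (x + t *\<^sub>R i)) has_derivative (\<lambda>t. (t *\<^sub>R i) \<bullet> D)) (at 0)"
        using has_derivative_compose[OF l, of w "\<lambda>h. h \<bullet> D"] wD by simp
      then have "DERIV (\<lambda>t. w (x + t *\<^sub>R i)) 0 :> i \<bullet> D"
        by (rule has_derivative_imp_has_field_derivative) (simp add: mult.commute)
      then have "((\<lambda>h. (w (x + h *\<^sub>R i) - w x) / h) \<longlongrightarrow> i \<bullet> D) (at 0)"
        by (simp add: DERIV_def)
      moreover have "filterlim (\<lambda>k. inverse (real (Suc k))) (at 0) sequentially"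
        using LIMSEQ_inverse_real_of_nat by (auto simp: filterlim_at)
      ultimately have "(\<lambda>k. (w (x + inverse (real (Suc k)) *\<^sub>R i) - w x) / inverse (real (Suc k)))
          \<longlonglongrightarrow> i \<bullet> D"
        by (rule filterlim_compose)
      then show "(\<lambda>k. (w (x + inverse (real (Suc k)) *\<^sub>R i) - w x) * real (Suc k)) \<longlonglongrightarrow> i \<bullet> D"
        by (simp add: divide_inverse)
    qed
    then have "g x = D" using euclidean_representation[of D] by (simp add: g_def inner_commute)
    show "P x"
      unfolding P_def
    proof
      fix k
      obtain d where d: "d > 0" "\<And>y. norm (y - x) < d \<Longrightarrow>
          norm (w y - w x - (y - x) \<bullet> D) \<le> inverse (real (Suc k)) * norm (y - x)"
        using wD unfolding has_derivative_at_alt by (metis inverse_positive_iff_positive of_nat_0_less_iff zero_less_Suc)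
      obtain j where "inverse (real (Suc j)) < d" using reals_Archimedean d(1) by blast
      then show "\<exists>j. \<forall>l. norm (\<eta> l) < inverse (real (Suc j)) \<longrightarrow>
          \<bar>w (x + \<eta> l) - w x - \<eta> l \<bullet> g x\<bar> \<le> inverse (real (Suc k)) * norm (\<eta> l)"
        using d(2)[of "x + \<eta> l" for l] \<open>g x = D\<close> by (intro exI[of _ j]) auto
    qed
  qed
  have eq: "gradient u x = (if P x then g x else 0)" if "x \<in> \<Omega>" for x
  proof (cases "P x")
    case True then show ?thesis using P1[OF that True] gradient_eqI by simp
  next
    case False
    then have "\<not> u differentiable (at x)" using P2[OF that] differentiable_imp_gderiv by blast
    then show ?thesis using False by (simp add: gradient_def)
  qed
  have "(\<lambda>x. if P x then g x else 0) \<in> borel_measurable borel" by measurable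
  then have "(\<lambda>x. if P x then g x else 0) \<in> borel_measurable (lebesgue_on S)"
    by (intro measurable_restrict_space1 measurable_completion) (simp add: measurable_lborel1)
  then show ?thesis
    by (rule measurable_cong[THEN iffD1, rotated]) (use S eq in auto)
qed

lemma Linfty_norm_bound:
  assumes \<Omega>: "open \<Omega>" and u: "continuous_on \<Omega> (u :: 'a::euclidean_space \<Rightarrow> real)"
    and fin: "Linfty_norm \<Omega> u \<noteq> \<infinity>" and x: "x \<in> \<Omega>"
  shows "ennreal \<bar>u x\<bar> \<le> Linfty_norm \<Omega> u"
proof (rule ccontr)
  assume neg: "\<not> ennreal \<bar>u x\<bar> \<le> Linfty_norm \<Omega> u"
  define N where "N = enn2real (Linfty_norm \<Omega> u)"
  have N: "Linfty_norm \<Omega> u = ennreal N" "N \<ge> 0" using fin by (auto simp: N_def less_top)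
  have AE: "AE y in lebesgue_on \<Omega>. \<bar>u y\<bar> \<le> N"
    using esssup_AE[of "\<lambda>x. ennreal (norm (u x))" "lebesgue_on \<Omega>"] N
    by (simp add: Linfty_norm_def)
  define U where "U = \<Omega> \<inter> (\<lambda>y. \<bar>u y\<bar>) -` {N<..}"
  have "open U" unfolding U_def
    by (intro continuous_open_preimage continuous_intros u \<Omega>)
  moreover have "x \<in> U" using neg x N by (auto simp: U_def not_le ennreal_less_iff)
  ultimately have "\<not> negligible U" using open_not_negligible by blast
  moreover have "negligible U"
  proof -
    have "AE y in lebesgue. y \<in> \<Omega> \<longrightarrow> \<bar>u y\<bar> \<le> N"
      using AE \<Omega> by (subst (asm) AE_restrict_space_iff) simp_all
    then have "AE y in lebesgue. y \<notin> U" by (rule eventually_mono) (auto simp: U_def)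
    moreover have "U \<in> sets lebesgue" using \<open>open U\<close> by simp
    ultimately show ?thesis by (simp add: negligible_iff_null_sets AE_iff_null_sets)
  qed
  ultimately show False by blast
qed

text \<open>If the distance is \<open>0\<close> although \<open>\<Omega>'\<close> is nonempty, then the frontier of \<open>\<Omega>\<close> is empty, so a ball
  of any radius will do, for instance of radius \<open>1\<close>.\<close>

lemma ball_setdist_frontier:
  assumes \<Omega>: "compactly_contained \<Omega>' \<Omega>" and x: "x \<in> \<Omega>'"
    and R: "R = (if setdist \<Omega>' (frontier \<Omega>) > 0 then setdist \<Omega>' (frontier \<Omega>) / 2 else 1)" and "open \<Omega>"
  shows "cball x R \<subseteq> (\<Omega> :: 'a::euclidean_space set)"
proof (rule ccontr)
  assume neg: "\<not> cball x R \<subseteq> \<Omega>"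
  have sub: "closure \<Omega>' \<subseteq> \<Omega>" "compact (closure \<Omega>')" using \<Omega> by (auto simp: compactly_contained_def)
  have "R > 0" by (simp add: R)
  have "x \<in> \<Omega>" using x sub(1) closure_subset by blast
  then have "cball x R \<inter> \<Omega> \<noteq> {}" using centre_in_cball[of x R] \<open>R > 0\<close> less_imp_le by blast
  then obtain z where z: "z \<in> cball x R" "z \<in> frontier \<Omega>"
    using connected_Int_frontier[OF connected_cball, of x R \<Omega>] neg by blast
  have "setdist \<Omega>' (frontier \<Omega>) \<le> R" using setdist_le_dist[OF x z(2)] z(1) by simp
  then have "\<not> setdist \<Omega>' (frontier \<Omega>) > 0" using R by auto
  then have "setdist \<Omega>' (frontier \<Omega>) = 0"
    using setdist_pos_le[of \<Omega>' "frontier \<Omega>"] by linarith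
  then have "setdist (closure \<Omega>') (frontier \<Omega>) = 0" by simp
  then have "closure \<Omega>' \<inter> frontier \<Omega> \<noteq> {}"
    using setdist_eq_0_compact_closed[OF sub(2) frontier_closed, of \<Omega>] x z(2) closure_subset by blast
  then show False using sub(1) \<open>open \<Omega>\<close> by (auto simp: frontier_def interior_open)
qed

theorem mainTheorem2:
  shows "\<exists>C :: real \<Rightarrow> real. (\<forall>d. C d > 0) \<and>
    (\<forall>(\<Omega> :: (real ^ 'n) set) (r :: real) (u :: real ^ 'n \<Rightarrow> real).
       open \<Omega> \<longrightarrow> r \<ge> 0 \<longrightarrow> viscosity_solution r \<Omega> u \<longrightarrow>
         locally_lipschitz_on \<Omega> u \<and>
         (\<forall>\<Omega>'. compactly_contained \<Omega>' \<Omega> \<longrightarrow>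
            Linfty_norm \<Omega>' (gradient u)
              \<le> ennreal (C (setdist \<Omega>' (frontier \<Omega>))) * (Linfty_norm \<Omega> u + 1)))"
proof -
  define R where "R d = (if d > 0 then d / 2 else 1)" for d :: real
  define C where "C d = 2 + R d + (12 + 2 * DIM(real ^ 'n)) / R d" for d
  have R: "R d > 0" for d by (simp add: R_def)
  have C: "C d > 0" for d using R[of d] by (simp add: C_def add_pos_nonneg)
  have bound: "Linfty_norm \<Omega>' (gradient u) \<le> ennreal (C (setdist \<Omega>' (frontier \<Omega>))) * (Linfty_norm \<Omega> u + 1)"
    if \<Omega>: "open \<Omega>" and r: "r \<ge> 0" and u: "viscosity_solution r \<Omega> u" and \<Omega>': "compactly_contained \<Omega>' \<Omega>"
    for \<Omega> \<Omega>' :: "(real ^ 'n) set" and r u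
  proof (cases "Linfty_norm \<Omega> u = \<infinity>")
    case True
    then show ?thesis
      using C[of "setdist \<Omega>' (frontier \<Omega>)"] by (simp add: ennreal_mult_top ennreal_eq_0_iff not_le)
  next
    case False
    have cu: "continuous_on \<Omega> u" using u by (simp add: viscosity_solution_def)
    have sub: "open \<Omega>'" "\<Omega>' \<subseteq> \<Omega>"
      using \<Omega>' closure_subset unfolding compactly_contained_def by blast+
    define d where "d = setdist \<Omega>' (frontier \<Omega>)"
    define N where "N = enn2real (Linfty_norm \<Omega> u)"
    have N: "Linfty_norm \<Omega> u = ennreal N" "N \<ge> 0" using False by (auto simp: N_def less_top)
    have uN: "\<bar>u x\<bar> \<le> N" if "x \<in> \<Omega>" for x
      using Linfty_norm_bound[OF \<Omega> cu False that] N by simp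
    define K where "K = 2 + 3 * R d / 8 + (12 + 2 * DIM(real ^ 'n)) * N / R d"
    have K: "K \<ge> 0" using R[of d] N(2) by (simp add: K_def)
    have KC: "K \<le> C d * (N + 1)"
    proof -
      have "R d * N \<ge> 0" "(12 + 2 * DIM(real ^ 'n)) / R d \<ge> 0" using R[of d] N(2) by simp_all
      moreover have "C d * (N + 1) = 2 * N + 2 + R d * N + R d + (12 + 2 * DIM(real ^ 'n)) * N / R d
          + (12 + 2 * DIM(real ^ 'n)) / R d"
        by (simp add: C_def algebra_simps add_divide_distrib)
      ultimately show ?thesis unfolding K_def using R[of d] N(2) by linarith
    qed
    have "norm (gradient u x) \<le> K" if "x \<in> \<Omega>'" for x
    proof (rule norm_gradient_le[of "R d / 2" K])
      have xR: "cball x (R d) \<subseteq> \<Omega>"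
        by (rule ball_setdist_frontier[OF \<Omega>' that _ \<Omega>]) (simp add: R_def d_def)
      show "u x - u y \<le> K * dist x y" if "dist x y \<le> R d / 2" for y
        unfolding K_def by (rule doubling_estimate[OF \<Omega> r u R xR uN that]) (use xR in blast)
    qed (use R[of d] K in auto)
    then have "AE x in lebesgue_on \<Omega>'. ennreal (norm (gradient u x)) \<le> ennreal (C d * (N + 1))"
      using KC by (intro AE_I2) (force intro: ennreal_leI)
    moreover have "(\<lambda>x. ennreal (norm (gradient u x))) \<in> borel_measurable (lebesgue_on \<Omega>')"
      using borel_measurable_gradient[OF \<Omega> cu sub] by measurable
    ultimately have "Linfty_norm \<Omega>' (gradient u) \<le> ennreal (C d * (N + 1))"
      unfolding Linfty_norm_def by (intro esssup_I)
    also have "\<dots> = ennreal (C d) * (Linfty_norm \<Omega> u + 1)"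
      using C[of d] N by (simp add: ennreal_mult ennreal_plus)
    finally show ?thesis by (simp add: d_def)
  qed
  show ?thesis
    using C bound locally_lipschitz_viscosity_solution by (intro exI[of _ C]) blast
qed

end
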